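(* (i) Let $\nu\in P_1(\mathcal{M})$. If $y\in\mathcal{M}$ and $(y_n)$ is a sequence in $\mathcal{M}$ with $\delta_R(y_n,y)\to0$, then $\lim_{n\to\infty}\mathrm{GDD}(\nu,y_n)=\mathrm{GDD}(\nu,y)$. Moreover the same continuity holds at points $y$ of the closure of $\mathcal{M}$ that are singular, with the convention $\mathrm{GDD}(\nu,y)=0$ for such $y$: if $(y_n)$ in $\mathcal{M}$ converges to a singular matrix $y$ in the sense that $\|\mathrm{Log}(y_n)\|_F\to\infty$, then $\mathrm{GDD}(\nu,y_n)\to0=\mathrm{GDD}(\nu,y)$. (ii) Let $\nu\in P_1(\mathcal{M})$ and let $(\nu_n)_{n\in\mathbb{N}}$ be a uniformly integrable sequence of Borel probability measures on $\mathcal{M}$ with $\nu_n\to\nu$ weakly. Then $\sup_{y\in\mathcal{M}}|\mathrm{GDD}(\nu_n,y)-\mathrm{GDD}(\nu,y)|\to0$ as $n\to\infty$.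
   Context: Let $\mathcal{M}$ be the set of $d\times d$ Hermitian positive definite matrices, $y\ast x:=y^*xy$, $y^{1/2}$ the HPD square root, $\mathrm{Log}$ the matrix logarithm, $\|\cdot\|_F$ the Frobenius norm. The affine-invariant Riemannian distance on $\mathcal{M}$ is $\delta_R(p_1,p_2)=\|\mathrm{Log}(p_1^{-1/2}\ast p_2)\|_F$. $P_1(\mathcal{M})$: Borel probability measures on $(\mathcal{M},\delta_R)$ with $\int\delta_R(y_0,x)\nu(dx)<\infty$ for some $y_0$. Weak convergence $\nu_n\to\nu$ means $\int\phi\,d\nu_n\to\int\phi\,d\nu$ for all bounded continuous $\phi$; $(\nu_n)$ is uniformly integrable if $\lim_{K\to\infty}\sup_n\int\delta_R(y_0,x)\mathbf{1}\{\delta_R(y_0,x)>K\}\nu_n(dx)=0$ for some $y_0\in\mathcal{M}$. The geodesic distance depth is $\mathrm{GDD}(\nu,y)=\exp(-\int_{\mathcal{M}}\delta_R(y,x)\,\nu(dx))$. *)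

theory Defs
  imports "HOL-Analysis.Analysis" "HOL-Probability.Probability"
begin

type_synonym 'n cmat = "complex ^ 'n ^ 'n"

definition adj :: "'n::finite cmat \<Rightarrow> 'n cmat" where
  "adj A = (\<chi> i j. cnj (A $ j $ i))"

definition hermitian :: "'n::finite cmat \<Rightarrow> bool" where
  "hermitian A \<longleftrightarrow> adj A = A"

definition hpd :: "'n::finite cmat \<Rightarrow> bool" where
  "hpd A \<longleftrightarrow> hermitian A \<and>
     (\<forall>x :: complex ^ 'n. x \<noteq> 0 \<longrightarrow> 0 < Re (\<Sum>i\<in>UNIV. \<Sum>j\<in>UNIV. cnj (x $ i) * A $ i $ j * x $ j))"

definition HPD :: "'n::finite cmat set" where
  "HPD = {A. hpd A}"

definition unitary :: "'n::finite cmat \<Rightarrow> bool" where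
  "unitary U \<longleftrightarrow> adj U ** U = mat 1"

definition cdiag :: "('n::finite \<Rightarrow> real) \<Rightarrow> 'n cmat" where
  "cdiag l = (\<chi> i j. if i = j then complex_of_real (l i) else 0)"

text \<open>Matrix inverse, HPD square root, and matrix logarithm of an HPD matrix
  (via a unitary diagonalisation; well-defined independently of the choice).\<close>
definition minv :: "'n::finite cmat \<Rightarrow> 'n cmat" where
  "minv A = (THE B. A ** B = mat 1 \<and> B ** A = mat 1)"

definition hpd_sqrt :: "'n::finite cmat \<Rightarrow> 'n cmat" where
  "hpd_sqrt A = (THE S. hpd S \<and> S ** S = A)"

definition mlog :: "'n::finite cmat \<Rightarrow> 'n cmat" where
  "mlog A = (SOME L. \<exists>U l. unitary U \<and> (\<forall>i. 0 < l i) \<and>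
       A = U ** cdiag l ** adj U \<and> L = U ** cdiag (\<lambda>i. ln (l i)) ** adj U)"

definition frob :: "'n::finite cmat \<Rightarrow> real" where
  "frob A = sqrt (\<Sum>i\<in>UNIV. \<Sum>j\<in>UNIV. (cmod (A $ i $ j))\<^sup>2)"

definition cong_act :: "'n::finite cmat \<Rightarrow> 'n cmat \<Rightarrow> 'n cmat" where
  "cong_act y x = adj y ** x ** y"

definition dR :: "'n::finite cmat \<Rightarrow> 'n cmat \<Rightarrow> real" where
  "dR p1 p2 = frob (mlog (cong_act (minv (hpd_sqrt p1)) p2))"

definition dR_open :: "'n::finite cmat set \<Rightarrow> bool" where
  "dR_open U \<longleftrightarrow> U \<subseteq> HPD \<and> (\<forall>x\<in>U. \<exists>e>0. {y\<in>HPD. dR x y < e} \<subseteq> U)"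

definition HPD_borel :: "'n::finite cmat measure" where
  "HPD_borel = sigma HPD {U. dR_open U}"

definition borel_prob_HPD :: "'n::finite cmat measure \<Rightarrow> bool" where
  "borel_prob_HPD \<nu> \<longleftrightarrow> prob_space \<nu> \<and> sets \<nu> = sets HPD_borel"

definition P1 :: "'n::finite cmat measure \<Rightarrow> bool" where
  "P1 \<nu> \<longleftrightarrow> borel_prob_HPD \<nu> \<and> (\<exists>y0\<in>HPD. (\<integral>\<^sup>+ x. ennreal (dR y0 x) \<partial>\<nu>) < \<infinity>)"

definition dR_continuous :: "('n::finite cmat \<Rightarrow> real) \<Rightarrow> bool" where
  "dR_continuous \<phi> \<longleftrightarrow>
     (\<forall>x\<in>HPD. \<forall>e>0. \<exists>d>0. \<forall>y\<in>HPD. dR x y < d \<longrightarrow> \<bar>\<phi> y - \<phi> x\<bar> < e)"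

definition weak_conv :: "(nat \<Rightarrow> 'n::finite cmat measure) \<Rightarrow> 'n cmat measure \<Rightarrow> bool" where
  "weak_conv \<nu>s \<nu> \<longleftrightarrow>
     (\<forall>\<phi>. dR_continuous \<phi> \<and> (\<exists>B. \<forall>x\<in>HPD. \<bar>\<phi> x\<bar> \<le> B) \<longrightarrow>
        (\<lambda>n. \<integral>x. \<phi> x \<partial>(\<nu>s n)) \<longlonglongrightarrow> (\<integral>x. \<phi> x \<partial>\<nu>))"

definition unif_integrable :: "(nat \<Rightarrow> 'n::finite cmat measure) \<Rightarrow> bool" where
  "unif_integrable \<nu>s \<longleftrightarrow> (\<exists>y0\<in>HPD.
     ((\<lambda>K::real. SUP n. \<integral>\<^sup>+ x. ennreal (dR y0 x * indicator {x. dR y0 x > K} x) \<partial>(\<nu>s n))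
        \<longlongrightarrow> 0) at_top)"

text \<open>Geodesic distance depth; the integral is taken as a nonnegative integral,
  with GDD = exp(-\<infinity>) = 0 if it is infinite.\<close>
definition GDD :: "'n::finite cmat measure \<Rightarrow> 'n cmat \<Rightarrow> real" where
  "GDD \<nu> y = (let I = \<integral>\<^sup>+ x. ennreal (dR y x) \<partial>\<nu> in
              if I = \<infinity> then 0 else exp (- enn2real I))"

end

theory Submission
  imports Defs "HOL-Real_Asymp.Real_Asymp"
begin

text \<open>
  The depth is a function of the mean distance, and mean distances are 1-Lipschitz in the base
  point because \<^term>\<open>dR\<close> is a metric; this gives (i) at once. For (ii), uniform integrability
  upgrades weak convergence to pointwise convergence of the mean distances, the depths vanish
  uniformly far away from the identity, and bounded sequences have convergent subsequences, so that
  a sequence of points violating uniform convergence cannot exist.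

  The triangle inequality for \<^term>\<open>dR\<close> needs neither matrix calculus nor majorization.
  Let \<open>P\<close>, \<open>Q\<close> be positive definite with log-eigenvalues \<open>m\<^sub>i\<close>, \<open>k\<^sub>j\<close> and let \<open>w\<^sub>i\<^sub>j\<close> be the squared
  moduli of the inner products of the eigenvectors, a doubly stochastic matrix. Then
  \<open>tr (P\<inverse>Q) + tr (Q\<inverse>P) - 2d = \<Sum> w\<^sub>i\<^sub>j (2 cosh (k\<^sub>j - m\<^sub>i) - 2) \<ge> \<Sum> w\<^sub>i\<^sub>j (k\<^sub>j - m\<^sub>i)\<^sup>2\<close>,
  and Minkowski's inequality in \<open>L\<^sup>2(w)\<close> compares the norms of \<open>k\<close> and \<open>m\<close>. The left side is invariant
  under congruence, so moving from \<open>N\<^sup>*N\<close> to \<open>N\<^sup>*exp(D)N\<close> in \<open>n\<close> equal steps costs at most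
  \<open>n (\<Sum> 2 cosh (d\<^sub>i/n) - 2)\<^sup>1\<^sup>/\<^sup>2\<close>, which tends to \<open>\<parallel>D\<parallel>\<close>.
\<close>

section \<open>Unitary diagonalization\<close>

lemma adj_nth [simp]: "adj A $ i $ j = cnj (A $ j $ i)"
  by (simp add: adj_def)

lemma cdiag_nth: "cdiag l $ i $ j = (if i = j then complex_of_real (l i) else 0)"
  by (simp add: cdiag_def)

lemma adj_adj [simp]: "adj (adj A) = A"
  by (simp add: vec_eq_iff)

lemma adj_mult: "adj (A ** B) = adj B ** adj A"
  by (simp add: vec_eq_iff matrix_matrix_mult_def mult.commute)

lemma adj_cdiag [simp]: "adj (cdiag l) = cdiag l"
  by (simp add: vec_eq_iff cdiag_nth)

lemma cdiag_one: "cdiag (\<lambda>_. 1) = mat 1"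
  by (simp add: vec_eq_iff cdiag_nth mat_def)

lemma adj_mat_1 [simp]: "adj (mat 1) = mat 1"
  by (simp flip: cdiag_one)

lemma cdiag_mult_left: "(cdiag l ** A) $ i $ j = complex_of_real (l i) * A $ i $ j"
  by (simp add: matrix_matrix_mult_def cdiag_nth if_distrib[where f="\<lambda>x. x * _"] cong: if_cong)

lemma cdiag_mult_right: "(A ** cdiag l) $ i $ j = A $ i $ j * complex_of_real (l j)"
  by (simp add: matrix_matrix_mult_def cdiag_nth if_distrib[where f="\<lambda>x. _ * x"] cong: if_cong)

lemma cdiag_mult: "cdiag a ** cdiag b = cdiag (\<lambda>i. a i * b i)"
  by (simp add: vec_eq_iff cdiag_mult_left) (simp add: cdiag_nth)

lemma unitaryD:
  assumes "unitary U"
  shows "adj U ** U = mat 1" "U ** adj U = mat 1"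
  using assms matrix_left_right_inverse unfolding unitary_def by blast+

lemma unitary_adj: "unitary U \<Longrightarrow> unitary (adj U)"
  by (simp add: unitary_def[of "adj U"] unitaryD)

lemma unitary_mult: "unitary U \<Longrightarrow> unitary V \<Longrightarrow> unitary (U ** V)"
  unfolding unitary_def adj_mult
  by (metis matrix_mul_assoc matrix_mul_lid)

lemma unitary_mat_1: "unitary (mat 1)"
  by (simp add: unitary_def)

lemma unitary_column_norm:
  assumes "unitary U"
  shows "(\<Sum>i\<in>UNIV. (cmod (U $ i $ j))\<^sup>2) = 1"
proof -
  have "complex_of_real (\<Sum>i\<in>UNIV. (cmod (U $ i $ j))\<^sup>2) = (adj U ** U) $ j $ j"
    by (simp add: matrix_matrix_mult_def complex_norm_square mult.commute del: of_real_power)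
  then show ?thesis
    using unitaryD(1)[OF assms] by (simp add: mat_def del: of_real_sum)
qed

lemma unitary_row_norm:
  assumes "unitary U"
  shows "(\<Sum>j\<in>UNIV. (cmod (U $ i $ j))\<^sup>2) = 1"
  using unitary_column_norm[OF unitary_adj[OF assms], of i] by simp

section \<open>Compactness of the unitary group\<close>

lemma continuous_on_matrix_mult:
  fixes f g :: "'a::topological_space \<Rightarrow> 'n::finite cmat"
  assumes "continuous_on S f" "continuous_on S g"
  shows "continuous_on S (\<lambda>x. f x ** g x)"
  unfolding matrix_matrix_mult_def
  by (intro continuous_intros continuous_on_vec_lambda assms)

lemma continuous_on_adj:
  fixes f :: "'a::topological_space \<Rightarrow> 'n::finite cmat"
  assumes "continuous_on S f"
  shows "continuous_on S (\<lambda>x. adj (f x))"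
  unfolding adj_def by (intro continuous_intros continuous_on_vec_lambda assms)

text \<open>Compactness serves twice: it yields the maximizer in the diagonalization, and later
  convergent subsequences of eigenbases.\<close>

lemma compact_unitary: "compact {U :: 'n::finite cmat. unitary U}"
proof (subst compact_eq_bounded_closed, intro conjI)
  have "norm U \<le> of_nat CARD('n) * of_nat CARD('n)" if "unitary U" for U :: "'n cmat"
  proof -
    have ent: "cmod (U $ i $ j) \<le> 1" for i j
    proof -
      have "(cmod (U $ i $ j))\<^sup>2 \<le> (\<Sum>i\<in>UNIV. (cmod (U $ i $ j))\<^sup>2)"
        by (rule member_le_sum) auto
      then show ?thesis using unitary_column_norm[OF that, of j] by (simp add: power_le_one_iff)
    qed
    have "norm U \<le> (\<Sum>i\<in>UNIV. norm (U $ i))"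
      by (simp add: norm_vec_def L2_set_le_sum)
    also have "\<dots> \<le> (\<Sum>i\<in>(UNIV::'n set). \<Sum>j\<in>(UNIV::'n set). 1)"
    proof (rule sum_mono)
      fix i
      have "norm (U $ i) \<le> (\<Sum>j\<in>UNIV. cmod (U $ i $ j))"
        by (simp add: norm_vec_def L2_set_le_sum)
      also have "\<dots> \<le> (\<Sum>j\<in>(UNIV::'n set). 1)"
        by (rule sum_mono) (rule ent)
      finally show "norm (U $ i) \<le> (\<Sum>j\<in>(UNIV::'n set). 1)" .
    qed
    finally show ?thesis by simp
  qed
  then show "bounded {U :: 'n cmat. unitary U}"
    unfolding bounded_iff by blast
  have "closed {U :: 'n cmat. adj U ** U = mat 1}"
    by (intro closed_Collect_eq continuous_on_matrix_mult continuous_on_adj continuous_intros)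
  then show "closed {U :: 'n cmat. unitary U}"
    by (simp add: unitary_def)
qed

text \<open>For \<open>p \<noteq> q\<close>, mixes coordinates \<open>p\<close> and \<open>q\<close>
  with real cosine \<open>c\<close> and complex sine \<open>z\<close>, and fixes the others. Columns
  \<open>p\<close> and \<open>q\<close> are written as sums of two conditionals so that a sum over
  the row index collapses termwise.\<close>

definition rotation :: "'n \<Rightarrow> 'n \<Rightarrow> real \<Rightarrow> complex \<Rightarrow> 'n::finite cmat" where
  "rotation p q c z = (\<chi> k j. if j = p then (if k = p then of_real c else 0) + (if k = q then z else 0)
     else if j = q then (if k = p then - cnj z else 0) + (if k = q then of_real c else 0)
     else if k = j then 1 else 0)"

lemma sum_rotation:
  fixes f :: "'n::finite \<Rightarrow> complex"
  shows "(\<Sum>k\<in>UNIV. f k * rotation p q c z $ k $ j) =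
     (if j = p then f p * of_real c + f q * z
      else if j = q then - (f p * cnj z) + f q * of_real c else f j)"
  by (simp add: rotation_def distrib_left sum.distrib if_distrib[where f="\<lambda>x. _ * x"] cong: if_cong)

lemma sum_cnj_rotation:
  fixes f :: "'n::finite \<Rightarrow> complex"
  shows "(\<Sum>k\<in>UNIV. cnj (rotation p q c z $ k $ j) * f k) =
     (if j = p then f p * of_real c + f q * cnj z
      else if j = q then - (f p * z) + f q * of_real c else f j)"
proof -
  have "(\<Sum>k\<in>UNIV. cnj (rotation p q c z $ k $ j) * f k)
      = cnj (\<Sum>k\<in>UNIV. cnj (f k) * rotation p q c z $ k $ j)"
    by (simp add: mult.commute)
  then show ?thesis unfolding sum_rotation by simp
qed

lemma unitary_rotation:
  assumes "p \<noteq> q" "c\<^sup>2 + (cmod z)\<^sup>2 = 1"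
  shows "unitary (rotation p q c z)"
proof -
  have 1: "complex_of_real c * complex_of_real c + z * cnj z = 1"
    using assms(2) by (metis complex_norm_square of_real_1 of_real_add of_real_power power2_eq_square)
  have "(adj (rotation p q c z) ** rotation p q c z) $ i $ j = (mat 1 :: 'a cmat) $ i $ j" for i j
    unfolding matrix_matrix_mult_def
    using 1 assms(1)
    by (simp add: sum_cnj_rotation) (auto simp: rotation_def mat_def algebra_simps)
  then show ?thesis by (simp add: unitary_def vec_eq_iff)
qed

text \<open>The term \<open>2 * c * Re (B $ p $ q * z)\<close> is the contribution of the
  off-diagonal entry; it enters the two affected diagonal places with opposite signs.\<close>

lemma rotation_conj_diag:
  fixes B :: "'n::finite cmat"
  assumes "p \<noteq> q" and "B $ q $ p = cnj (B $ p $ q)"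
  shows "Re ((adj (rotation p q c z) ** B ** rotation p q c z) $ j $ j) =
    (if j = p then c\<^sup>2 * Re (B $ p $ p) + (cmod z)\<^sup>2 * Re (B $ q $ q) + 2 * c * Re (B $ p $ q * z)
     else if j = q then (cmod z)\<^sup>2 * Re (B $ p $ p) + c\<^sup>2 * Re (B $ q $ q) - 2 * c * Re (B $ p $ q * z)
     else Re (B $ j $ j))"
  unfolding matrix_matrix_mult_def cmod_power2
  using assms
  by (simp add: sum_rotation sum_cnj_rotation) (simp add: power2_eq_square algebra_simps)

text \<open>Jacobi's method: if a unitary \<open>U\<close> maximizes the sum of squares of the diagonal of
  \<open>U\<^sup>*AU\<close>, then a plane rotation against any nonzero off-diagonal entry would increase it.\<close>

lemma hermitian_diagonalization:
  fixes A :: "'n::finite cmat"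
  assumes "hermitian A"
  obtains U l where "unitary U" "A = U ** cdiag l ** adj U"
proof -
  define f where "f U = (\<Sum>i\<in>UNIV. (Re ((adj U ** A ** U) $ i $ i))\<^sup>2)" for U :: "'n cmat"
  have "continuous_on {U. unitary U} f"
    unfolding f_def
    by (intro continuous_intros continuous_on_matrix_mult continuous_on_adj)
  then obtain U where U: "unitary U" and max: "\<And>V. unitary V \<Longrightarrow> f V \<le> f U"
    using continuous_attains_sup[OF compact_unitary, of f] unitary_mat_1 by blast
  define B where "B = adj U ** A ** U"
  have adjB: "adj B = B"
    using assms by (simp add: B_def adj_mult hermitian_def matrix_mul_assoc)
  have herm: "B $ j $ i = cnj (B $ i $ j)" for i j
    using adjB by (metis adj_nth)
  \<comment> \<open>Ordering the two diagonal entries makes their gap \<open>D\<close> nonnegative,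
    so that pushing them apart raises the sum of squares. The other order is covered below by
    exchanging \<open>p\<close> and \<open>q\<close>.\<close>
  have le: "B $ p $ q = 0" if pq: "p \<noteq> q" and ge: "Re (B $ p $ p) \<ge> Re (B $ q $ q)" for p q
  proof (rule ccontr)
    assume nz: "B $ p $ q \<noteq> 0"
    define b where "b = cmod (B $ p $ q)"
    have b: "b > 0" using nz by (simp add: b_def)
    define D where "D = Re (B $ p $ p) - Re (B $ q $ q)"
    have D: "D \<ge> 0" using ge by (simp add: D_def)
    \<comment> \<open>The scale is small enough for \<open>c \<ge> 1/2\<close> and
      \<open>\<tau> * D \<le> 1/2\<close>, which keeps the factor \<open>2 * c - \<tau> * D\<close>
      of the gain \<open>e\<close> positive.\<close>
    define \<tau> where "\<tau> = 1 / (2 * (1 + b + D))"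
    have \<tau>: "\<tau> > 0" "\<tau> * b \<le> 1/2" "\<tau> * D \<le> 1/2"
      using b D by (auto simp: \<tau>_def field_simps)
    define c where "c = sqrt (1 - (\<tau> * b)\<^sup>2)"
    have tb: "(\<tau> * b)\<^sup>2 \<le> (1/2)\<^sup>2"
      using \<tau> b by (intro power_mono) auto
    have c: "c\<^sup>2 = 1 - (\<tau> * b)\<^sup>2" "c \<ge> 1/2"
      unfolding c_def using tb by (simp add: power_one_over)
        (rule real_le_rsqrt, use tb in \<open>simp add: power_one_over\<close>)
    \<comment> \<open>The phase of \<open>z\<close> cancels that of the entry, so that
      \<open>B $ p $ q * z\<close> is real and positive.\<close>
    define z where "z = of_real \<tau> * cnj (B $ p $ q)"
    have z: "cmod z = \<tau> * b" using \<tau>(1) by (simp add: z_def b_def norm_mult)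
    have bz: "Re (B $ p $ q * z) = \<tau> * b\<^sup>2"
      unfolding z_def b_def cmod_power2 by (simp add: algebra_simps power2_eq_square)
    define G where "G = rotation p q c z"
    have G: "unitary G" unfolding G_def using pq c z by (intro unitary_rotation) auto
    \<comment> \<open>The amount moved from diagonal entry \<open>q\<close> to diagonal entry
      \<open>p\<close>: the cross term \<open>2 * c * \<tau> * b^2\<close> less the averaging loss
      \<open>(\<tau> * b)^2 * D\<close>.\<close>
    define e where "e = \<tau> * b\<^sup>2 * (2 * c - \<tau> * D)"
    have e: "e > 0" unfolding e_def using \<tau> b c(2) by (intro mult_pos_pos) auto
    have diag: "Re ((adj G ** B ** G) $ j $ j) = (if j = p then Re (B $ p $ p) + e
        else if j = q then Re (B $ q $ q) - e else Re (B $ j $ j))" for j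
      unfolding G_def rotation_conj_diag[OF pq herm] z c bz e_def D_def
      by (auto simp: algebra_simps power2_eq_square)
    have fUG: "f (U ** G) = (\<Sum>j\<in>UNIV. (Re ((adj G ** B ** G) $ j $ j))\<^sup>2)"
      by (simp add: f_def B_def adj_mult matrix_mul_assoc)
    have split: "sum g UNIV = g p + g q + sum g (UNIV - {p, q})" for g :: "'n \<Rightarrow> real"
      using pq by (subst sum.subset_diff[of "{p,q}"]) auto
    have "f (U ** G) = (Re (B $ p $ p) + e)\<^sup>2 + (Re (B $ q $ q) - e)\<^sup>2
        + (\<Sum>j\<in>UNIV - {p, q}. (Re (B $ j $ j))\<^sup>2)"
      unfolding fUG split using pq by (auto simp: diag intro!: sum.cong)
    moreover have "f U = (Re (B $ p $ p))\<^sup>2 + (Re (B $ q $ q))\<^sup>2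
        + (\<Sum>j\<in>UNIV - {p, q}. (Re (B $ j $ j))\<^sup>2)"
      unfolding f_def B_def[symmetric] by (rule split)
    ultimately have "f (U ** G) - f U = 2 * e * D + 2 * e\<^sup>2"
      by (simp add: D_def power2_eq_square algebra_simps)
    moreover have "2 * e * D + 2 * e\<^sup>2 > 0"
      using e D by (intro add_nonneg_pos) auto
    ultimately show False
      using max[OF unitary_mult[OF U G]] by linarith
  qed
  have off: "B $ p $ q = 0" if "p \<noteq> q" for p q
    using le[OF that] le[of q p] that herm[of p q] by (cases "Re (B $ p $ p) \<ge> Re (B $ q $ q)") auto
  have "B = cdiag (\<lambda>i. Re (B $ i $ i))"
  proof -
    have "B $ i $ i = of_real (Re (B $ i $ i))" for i
      using herm[of i i] by (simp add: complex_eq_iff)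
    then show ?thesis
      using off by (auto simp: vec_eq_iff cdiag_nth)
  qed
  moreover have "A = U ** B ** adj U"
  proof -
    have "U ** B ** adj U = (U ** adj U) ** A ** (U ** adj U)"
      by (simp add: B_def matrix_mul_assoc)
    then show ?thesis using unitaryD(2)[OF U] by simp
  qed
  ultimately show ?thesis using that U by metis
qed

section \<open>Logarithms of the spectrum\<close>

abbreviation (input) lognorm :: "'n::finite cmat \<Rightarrow> real" where
  "lognorm A \<equiv> frob (mlog A)"

text \<open>Writing the eigenvalues as \<open>exp (m i)\<close> builds in positivity and turns
  inversion and square root into negating and halving \<open>m\<close>.\<close>

definition log_spectral :: "'n::finite cmat \<Rightarrow> ('n \<Rightarrow> real) \<Rightarrow> 'n cmat \<Rightarrow> bool" where
  "log_spectral U m A \<longleftrightarrow> unitary U \<and> A = U ** cdiag (\<lambda>i. exp (m i)) ** adj U"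

lemma invertible_unitary: "unitary U \<Longrightarrow> invertible U"
  unfolding invertible_def using unitaryD by blast

text \<open>In the coordinates \<open>N *v x\<close> the form is diagonal. This is used in both
  directions: positive \<open>l\<close> makes a congruence positive definite, and positive
  definiteness forces positive eigenvalues.\<close>

lemma quadratic_form_congruence:
  "Re (\<Sum>i\<in>UNIV. \<Sum>j\<in>UNIV. cnj (x $ i) * (adj N ** cdiag l ** N) $ i $ j * x $ j)
     = (\<Sum>k\<in>UNIV. l k * (cmod ((N *v x) $ k))\<^sup>2)"
proof -
  have "(\<Sum>i\<in>UNIV. \<Sum>j\<in>UNIV. cnj (x $ i) * (adj N ** cdiag l ** N) $ i $ j * x $ j)
     = (\<Sum>i\<in>UNIV. \<Sum>j\<in>UNIV. \<Sum>k\<in>UNIV. of_real (l k) * (cnj (N $ k $ i * x $ i) * (N $ k $ j * x $ j)))"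
    unfolding matrix_mul_assoc[symmetric]
    by (simp add: matrix_matrix_mult_def[of "adj N"] cdiag_mult_left sum_distrib_left sum_distrib_right mult_ac)
  also have "\<dots> = (\<Sum>i\<in>UNIV. \<Sum>k\<in>UNIV. \<Sum>j\<in>UNIV. of_real (l k) * (cnj (N $ k $ i * x $ i) * (N $ k $ j * x $ j)))"
    by (intro sum.cong refl sum.swap)
  also have "\<dots> = (\<Sum>k\<in>UNIV. \<Sum>i\<in>UNIV. \<Sum>j\<in>UNIV. of_real (l k) * (cnj (N $ k $ i * x $ i) * (N $ k $ j * x $ j)))"
    by (rule sum.swap)
  also have "\<dots> = (\<Sum>k\<in>UNIV. of_real (l k) * (cnj ((N *v x) $ k) * (N *v x) $ k))"
    by (simp only: matrix_vector_mult_def vec_lambda_beta cnj_sum sum_product)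
       (simp only: sum_distrib_left)
  also have "\<dots> = (\<Sum>k\<in>UNIV. of_real (l k * (cmod ((N *v x) $ k))\<^sup>2))"
    unfolding of_real_mult complex_norm_square by (simp only: mult.commute)
  finally show ?thesis by simp
qed

lemma hpd_congruence:
  assumes "invertible N" and "\<And>i. l i > 0"
  shows "hpd (adj N ** cdiag l ** N)"
  unfolding hpd_def quadratic_form_congruence
proof (intro conjI allI impI)
  show "hermitian (adj N ** cdiag l ** N)"
    by (simp add: hermitian_def adj_mult matrix_mul_assoc)
  fix x :: "complex ^ 'a" assume "x \<noteq> 0"
  then have "N *v x \<noteq> 0"
    using assms(1) unfolding invertible_def
    by (metis matrix_vector_mul_assoc matrix_vector_mul_lid matrix_vector_mult_0_right)
  then obtain k where "(N *v x) $ k \<noteq> 0" by (auto simp: vec_eq_iff)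
  then have "l k * (cmod ((N *v x) $ k))\<^sup>2 > 0" using assms(2) by simp
  moreover have "l k * (cmod ((N *v x) $ k))\<^sup>2 \<ge> 0" for k
    using assms(2)[of k] by simp
  ultimately show "(\<Sum>k\<in>UNIV. l k * (cmod ((N *v x) $ k))\<^sup>2) > 0"
    by (intro sum_pos2[of _ k]) auto
qed

lemma log_spectral_hpd: "log_spectral U m A \<Longrightarrow> hpd A"
  unfolding log_spectral_def
  using hpd_congruence[of "adj U" "\<lambda>i. exp (m i)"] by (simp add: invertible_unitary unitary_adj)

lemma hpd_log_spectral:
  assumes "hpd A"
  obtains U m where "log_spectral U m A"
proof -
  obtain U l where U: "unitary U" and A: "A = U ** cdiag l ** adj U"
    using hermitian_diagonalization assms unfolding hpd_def by blast
  have "l i > 0" for i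
  proof -
    \<comment> \<open>Testing the form on the \<open>i\<close>-th column of \<open>U\<close>
      isolates \<open>l i\<close>.\<close>
    let ?x = "U *v axis i 1"
    have e: "adj U *v ?x = axis i 1"
      by (simp add: matrix_vector_mul_assoc unitaryD[OF U])
    then have "?x \<noteq> 0" by (metis matrix_vector_mult_0_right axis_eq_0_iff zero_neq_one)
    then have "0 < Re (\<Sum>i\<in>UNIV. \<Sum>j\<in>UNIV. cnj (?x $ i) * (adj (adj U) ** cdiag l ** adj U) $ i $ j * ?x $ j)"
      using assms A unfolding hpd_def by simp
    also have "\<dots> = (\<Sum>k\<in>UNIV. l k * (cmod ((axis i 1 :: complex ^ 'a) $ k))\<^sup>2)"
      unfolding quadratic_form_congruence e ..
    also have "\<dots> = (\<Sum>k\<in>UNIV. if k = i then l k else 0)"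
      by (rule sum.cong) (auto simp: axis_def)
    finally show ?thesis by simp
  qed
  then have "log_spectral U (\<lambda>i. ln (l i)) A"
    using U A by (simp add: log_spectral_def)
  then show ?thesis using that by blast
qed

text \<open>The change of basis \<open>adj U ** V\<close> intertwines the two diagonal matrices, so
  each entry is multiplied by \<open>exp (m i)\<close> on one side and by \<open>exp (k j)\<close>
  on the other; a nonzero entry can be cancelled.\<close>

lemma log_spectral_unique:
  assumes "log_spectral U m A" "log_spectral V k A" "(adj U ** V) $ i $ j \<noteq> 0"
  shows "m i = k j"
proof -
  have U: "unitary U" and V: "unitary V"
    and eq: "U ** cdiag (\<lambda>i. exp (m i)) ** adj U = V ** cdiag (\<lambda>i. exp (k i)) ** adj V"
    using assms unfolding log_spectral_def by auto
  have "cdiag (\<lambda>i. exp (m i)) ** (adj U ** V) = adj U ** (U ** cdiag (\<lambda>i. exp (m i)) ** adj U) ** V"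
    by (simp add: matrix_mul_assoc unitaryD[OF U])
  also have "\<dots> = adj U ** V ** cdiag (\<lambda>i. exp (k i)) ** (adj V ** V)"
    unfolding eq by (simp add: matrix_mul_assoc)
  finally have "(cdiag (\<lambda>i. exp (m i)) ** (adj U ** V)) $ i $ j = (adj U ** V ** cdiag (\<lambda>i. exp (k i))) $ i $ j"
    using unitaryD(1)[OF V] by simp
  then have "complex_of_real (exp (m i)) = complex_of_real (exp (k j))"
    unfolding cdiag_mult_left cdiag_mult_right using assms(3) by simp
  then show ?thesis unfolding of_real_eq_iff by simp
qed

text \<open>The squared moduli of a unitary are doubly stochastic. Sums over either spectrum thus
  become sums over the same index pairs, where spectra in different bases can be compared.\<close>

lemma double_sum_weights:
  assumes "unitary W"
  shows "(\<Sum>i\<in>UNIV. \<Sum>j\<in>UNIV. (cmod (W $ i $ j))\<^sup>2 * f i) = sum f UNIV"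
    and "(\<Sum>i\<in>UNIV. \<Sum>j\<in>UNIV. (cmod (W $ i $ j))\<^sup>2 * f j) = sum f UNIV"
proof -
  show "(\<Sum>i\<in>UNIV. \<Sum>j\<in>UNIV. (cmod (W $ i $ j))\<^sup>2 * f i) = sum f UNIV"
    by (simp add: unitary_row_norm[OF assms] flip: sum_distrib_right)
  show "(\<Sum>i\<in>UNIV. \<Sum>j\<in>UNIV. (cmod (W $ i $ j))\<^sup>2 * f j) = sum f UNIV"
    by (subst sum.swap) (simp add: unitary_column_norm[OF assms] flip: sum_distrib_right)
qed

text \<open>After both sums are spread over pairs, the terms agree: the weight is zero or
  \<open>m i = k j\<close>.\<close>

lemma log_spectral_sum_eq:
  assumes "log_spectral U m A" "log_spectral V k A"
  shows "(\<Sum>i\<in>UNIV. (m i)\<^sup>2) = (\<Sum>i\<in>UNIV. (k i)\<^sup>2)"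
proof -
  have W: "unitary (adj U ** V)"
    using assms unfolding log_spectral_def by (simp add: unitary_mult unitary_adj)
  show ?thesis
    unfolding double_sum_weights(1)[OF W, symmetric, of "\<lambda>i. (m i)\<^sup>2"]
      double_sum_weights(2)[OF W, symmetric, of "\<lambda>i. (k i)\<^sup>2"]
  proof (intro sum.cong refl)
    fix i j show "(cmod ((adj U ** V) $ i $ j))\<^sup>2 * (m i)\<^sup>2 = (cmod ((adj U ** V) $ i $ j))\<^sup>2 * (k j)\<^sup>2"
      using log_spectral_unique[OF assms, of i j] by (cases "(adj U ** V) $ i $ j = 0") auto
  qed
qed

lemma trace_conj_unitary:
  assumes "unitary U"
  shows "trace (U ** X ** adj U) = trace X"
proof -
  have "trace (U ** X ** adj U) = trace (adj U ** (U ** X))" by (rule trace_mul_sym)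
  then show ?thesis by (simp add: matrix_mul_assoc unitaryD[OF assms])
qed

lemma trace_cdiag: "trace (cdiag l) = of_real (sum l UNIV)"
  by (simp add: trace_def cdiag_nth)

lemma frob_squared: "(frob A)\<^sup>2 = Re (trace (adj A ** A))"
proof -
  have "(frob A)\<^sup>2 = (\<Sum>i\<in>UNIV. \<Sum>j\<in>UNIV. (cmod (A $ i $ j))\<^sup>2)"
    unfolding frob_def by (simp add: sum_nonneg)
  also have "\<dots> = (\<Sum>j\<in>UNIV. \<Sum>i\<in>UNIV. Re (cnj (A $ i $ j) * A $ i $ j))"
    by (subst sum.swap, simp add: cmod_power2) (simp add: power2_eq_square)
  finally show ?thesis by (simp add: trace_def matrix_matrix_mult_def)
qed

lemma frob_nonneg: "frob A \<ge> 0"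
  by (simp add: frob_def sum_nonneg)

lemma frob_unitary_diag:
  assumes "unitary U"
  shows "frob (U ** cdiag l ** adj U) = sqrt (\<Sum>i\<in>UNIV. (l i)\<^sup>2)"
proof -
  let ?X = "U ** cdiag l ** adj U"
  have "adj ?X ** ?X = U ** cdiag l ** (adj U ** U) ** cdiag l ** adj U"
    by (simp add: adj_mult matrix_mul_assoc)
  also have "\<dots> = U ** (cdiag l ** cdiag l) ** adj U"
    by (simp add: unitaryD[OF assms] matrix_mul_assoc)
  finally have "(frob ?X)\<^sup>2 = (\<Sum>i\<in>UNIV. (l i)\<^sup>2)"
    unfolding frob_squared by (simp only: trace_conj_unitary[OF assms] cdiag_mult trace_cdiag)
      (simp add: power2_eq_square)
  then show ?thesis by (metis frob_nonneg real_sqrt_unique)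
qed

text \<open>\<open>mlog\<close> selects some diagonalization; since the sum of squared
  log-eigenvalues is the same for all of them, any spectral data of \<open>A\<close> may be used to
  compute the norm.\<close>

lemma lognorm_eq:
  assumes "log_spectral U m A"
  shows "lognorm A = sqrt (\<Sum>i\<in>UNIV. (m i)\<^sup>2)"
proof -
  let ?P = "\<lambda>L. \<exists>U l. unitary U \<and> (\<forall>i. 0 < l i) \<and>
       A = U ** cdiag l ** adj U \<and> L = U ** cdiag (\<lambda>i. ln (l i)) ** adj U"
  have "?P (U ** cdiag m ** adj U)"
    using assms unfolding log_spectral_def
    by (intro exI[of _ U] exI[of _ "\<lambda>i. exp (m i)"]) auto
  then have "?P (mlog A)" unfolding mlog_def by (rule someI)
  then obtain V l where V: "unitary V" and l: "\<And>i. 0 < l i"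
    and A: "A = V ** cdiag l ** adj V" and L: "mlog A = V ** cdiag (\<lambda>i. ln (l i)) ** adj V" by blast
  have "log_spectral V (\<lambda>i. ln (l i)) A" using V l A by (simp add: log_spectral_def)
  from log_spectral_sum_eq[OF assms this] show ?thesis
    unfolding L frob_unitary_diag[OF V] by simp
qed

section \<open>Inverses, square roots and congruences\<close>

lemma minv_eq:
  assumes "A ** B = mat 1"
  shows "minv A = B"
proof -
  have BA: "B ** A = mat 1" using assms matrix_left_right_inverse by blast
  show ?thesis unfolding minv_def
  proof (rule the_equality)
    show "A ** B = mat 1 \<and> B ** A = mat 1" using assms BA by blast
    fix C assume "A ** C = mat 1 \<and> C ** A = mat 1"
    then show "C = B" using assms by (metis matrix_mul_assoc matrix_mul_lid matrix_mul_rid)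
  qed
qed

lemma unitary_diag_mult:
  assumes "unitary U"
  shows "(U ** cdiag a ** adj U) ** (U ** cdiag b ** adj U) = U ** cdiag (\<lambda>i. a i * b i) ** adj U"
proof -
  have "(U ** cdiag a ** adj U) ** (U ** cdiag b ** adj U) = U ** cdiag a ** (adj U ** U) ** cdiag b ** adj U"
    by (simp add: matrix_mul_assoc)
  then show ?thesis by (simp add: unitaryD[OF assms] cdiag_mult flip: matrix_mul_assoc)
qed

lemma log_spectral_minv:
  assumes "log_spectral U m A"
  shows "log_spectral U (\<lambda>i. - m i) (minv A)" "A ** minv A = mat 1" "minv A ** A = mat 1"
proof -
  have U: "unitary U" and A: "A = U ** cdiag (\<lambda>i. exp (m i)) ** adj U"
    using assms by (auto simp: log_spectral_def)
  let ?B = "U ** cdiag (\<lambda>i. exp (- m i)) ** adj U"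
  have AB: "A ** ?B = mat 1"
    unfolding A unitary_diag_mult[OF U] by (simp add: cdiag_one unitaryD[OF U] flip: exp_add)
  then have B: "minv A = ?B" by (rule minv_eq)
  show "log_spectral U (\<lambda>i. - m i) (minv A)" "A ** minv A = mat 1"
    using AB B U by (auto simp: log_spectral_def)
  then show "minv A ** A = mat 1" using matrix_left_right_inverse by blast
qed

lemma log_spectral_hpd_sqrt:
  assumes "log_spectral U m A"
  shows "log_spectral U (\<lambda>i. m i / 2) (hpd_sqrt A)" "hpd_sqrt A ** hpd_sqrt A = A"
proof -
  have U: "unitary U" and A: "A = U ** cdiag (\<lambda>i. exp (m i)) ** adj U"
    using assms by (auto simp: log_spectral_def)
  define S where "S = U ** cdiag (\<lambda>i. exp (m i / 2)) ** adj U"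
  have S: "log_spectral U (\<lambda>i. m i / 2) S" using U by (simp add: S_def log_spectral_def)
  have SS: "S ** S = A" unfolding S_def A unitary_diag_mult[OF U] by (simp flip: exp_add)
  have "hpd_sqrt A = S" unfolding hpd_sqrt_def
  proof (rule the_equality)
    show "hpd S \<and> S ** S = A" using log_spectral_hpd[OF S] SS by blast
    fix T assume T: "hpd T \<and> T ** T = A"
    then obtain V k where Vk: "log_spectral V k T" using hpd_log_spectral by blast
    then have V: "unitary V" and TV: "T = V ** cdiag (\<lambda>i. exp (k i)) ** adj V"
      by (auto simp: log_spectral_def)
    have "A = V ** cdiag (\<lambda>i. exp (2 * k i)) ** adj V"
      using T unfolding TV unitary_diag_mult[OF V] by (simp flip: exp_add)
    then have AV: "log_spectral V (\<lambda>i. 2 * k i) A" using V by (simp add: log_spectral_def)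
    \<comment> \<open>The other root \<open>T\<close> gives \<open>A\<close> the log-eigenvalues
      \<open>2 * k j\<close>, so uniqueness of the spectrum shows that the basis change intertwines
      the roots as well; unwinding this gives \<open>T = S\<close>.\<close>
    have "cdiag (\<lambda>i. exp (m i / 2)) ** (adj U ** V) = (adj U ** V) ** cdiag (\<lambda>i. exp (k i))"
      unfolding vec_eq_iff cdiag_mult_left cdiag_mult_right
    proof (intro allI)
      fix i j show "complex_of_real (exp (m i / 2)) * (adj U ** V) $ i $ j =
          (adj U ** V) $ i $ j * complex_of_real (exp (k j))"
        using log_spectral_unique[OF assms AV, of i j] by (cases "(adj U ** V) $ i $ j = 0") auto
    qed
    then have "U ** (cdiag (\<lambda>i. exp (m i / 2)) ** (adj U ** V)) ** adj V
        = U ** ((adj U ** V) ** cdiag (\<lambda>i. exp (k i))) ** adj V" by simp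
    moreover have "U ** (cdiag (\<lambda>i. exp (m i / 2)) ** (adj U ** V)) ** adj V = S ** (V ** adj V)"
      by (simp add: S_def matrix_mul_assoc)
    moreover have "U ** ((adj U ** V) ** cdiag (\<lambda>i. exp (k i))) ** adj V = (U ** adj U) ** T"
      by (simp add: TV matrix_mul_assoc)
    ultimately show "T = S" by (simp add: unitaryD[OF U] unitaryD[OF V])
  qed
  then show "log_spectral U (\<lambda>i. m i / 2) (hpd_sqrt A)" "hpd_sqrt A ** hpd_sqrt A = A"
    using S SS by auto
qed

lemma hpd_adj: "hpd A \<Longrightarrow> adj A = A"
  by (simp add: hpd_def hermitian_def)

lemma minv_hpd_sqrt:
  assumes "hpd A"
  defines "a \<equiv> minv (hpd_sqrt A)"
  shows "adj a = a" "invertible a" "a ** A ** a = mat 1"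
    "hpd_sqrt A ** a = mat 1" "a ** hpd_sqrt A = mat 1"
proof -
  obtain U m where Um: "log_spectral U m A" using assms hpd_log_spectral by blast
  note s = log_spectral_hpd_sqrt[OF Um]
  note i = log_spectral_minv[OF s(1), folded a_def]
  show "adj a = a" using log_spectral_hpd[OF i(1)] hpd_adj by blast
  show 1: "hpd_sqrt A ** a = mat 1" and 2: "a ** hpd_sqrt A = mat 1" using i by auto
  then show "invertible a" unfolding invertible_def by blast
  show "a ** A ** a = mat 1" using 1 2
    by (subst s(2)[symmetric]) (metis matrix_mul_assoc matrix_mul_lid)
qed

lemma hpd_minv:
  assumes "hpd A"
  shows "A ** minv A = mat 1" "minv A ** A = mat 1"
  using assms hpd_log_spectral log_spectral_minv by metis+

lemma hpd_congruence_hpd: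
  assumes "hpd A" "invertible N"
  shows "hpd (adj N ** A ** N)"
proof -
  obtain U m where "log_spectral U m A" using assms hpd_log_spectral by blast
  then have U: "unitary U" and A: "A = U ** cdiag (\<lambda>i. exp (m i)) ** adj U"
    by (auto simp: log_spectral_def)
  have "adj N ** A ** N = adj (adj U ** N) ** cdiag (\<lambda>i. exp (m i)) ** (adj U ** N)"
    by (simp add: A adj_mult matrix_mul_assoc)
  moreover have "invertible (adj U ** N)"
    by (intro invertible_mult invertible_unitary unitary_adj U assms)
  ultimately show ?thesis by (simp add: hpd_congruence)
qed

section \<open>The triangle inequality\<close>

text \<open>A congruence-invariant substitute for the squared distance; subtracting twice the
  dimension makes it vanish for equal positive definite arguments.\<close>

definition trace_gap :: "'n::finite cmat \<Rightarrow> 'n cmat \<Rightarrow> real" where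
  "trace_gap P Q = Re (trace (minv P ** Q)) + Re (trace (minv Q ** P)) - 2 * of_nat CARD('n)"

lemma trace_unitary_diag_mult:
  assumes "unitary U" "unitary V"
  shows "Re (trace ((U ** cdiag a ** adj U) ** (V ** cdiag b ** adj V)))
     = (\<Sum>i\<in>UNIV. \<Sum>j\<in>UNIV. (cmod ((adj U ** V) $ i $ j))\<^sup>2 * (a i * b j))"
proof -
  let ?W = "adj U ** V"
  have "(U ** cdiag a ** adj U) ** (V ** cdiag b ** adj V)
      = U ** (cdiag a ** ?W ** cdiag b ** adj ?W) ** adj U ** (U ** adj U)"
    by (simp add: adj_mult matrix_mul_assoc unitaryD[OF assms(1)])
      (simp add: unitaryD[OF assms(1)] flip: matrix_mul_assoc)
  then have "trace ((U ** cdiag a ** adj U) ** (V ** cdiag b ** adj V))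
      = trace (cdiag a ** ?W ** cdiag b ** adj ?W)"
    by (simp add: unitaryD[OF assms(1)] trace_conj_unitary[OF assms(1)] )
  also have "\<dots> = (\<Sum>i\<in>UNIV. \<Sum>j\<in>UNIV. of_real (a i) * ?W $ i $ j * of_real (b j) * cnj (?W $ i $ j))"
    unfolding trace_def matrix_matrix_mult_def[of "cdiag a ** ?W ** cdiag b" "adj ?W"]
    by (simp add: cdiag_mult_left cdiag_mult_right)
  also have "\<dots> = of_real (\<Sum>i\<in>UNIV. \<Sum>j\<in>UNIV. (cmod (?W $ i $ j))\<^sup>2 * (a i * b j))"
    unfolding of_real_sum of_real_mult complex_norm_square by (simp add: mult_ac)
  finally show ?thesis by simp
qed

text \<open>Both traces carry the same weights, as \<open>trace_mul_sym\<close> puts the second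
  product in an order with \<open>U\<close> before \<open>V\<close>. Since the weights sum to the
  dimension, the constant is absorbed as \<open>- 2\<close> in every bracket.\<close>

lemma trace_gap_eq:
  assumes "log_spectral U m P" "log_spectral V k Q"
  shows "trace_gap P Q = (\<Sum>i\<in>UNIV. \<Sum>j\<in>UNIV. (cmod ((adj U ** V) $ i $ j))\<^sup>2 *
    (exp (k j - m i) + exp (m i - k j) - 2))"
proof -
  have U: "unitary U" and V: "unitary V" using assms by (auto simp: log_spectral_def)
  have W: "unitary (adj U ** V)" using U V by (simp add: unitary_mult unitary_adj)
  have 1: "Re (trace (minv P ** Q)) =
      (\<Sum>i\<in>UNIV. \<Sum>j\<in>UNIV. (cmod ((adj U ** V) $ i $ j))\<^sup>2 * exp (k j - m i))"
    using log_spectral_minv(1)[OF assms(1)] assms(2)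
    unfolding log_spectral_def using trace_unitary_diag_mult[OF U V]
    by (simp add: mult.commute flip: exp_add)
  have "trace (minv Q ** P) = trace (P ** minv Q)" by (rule trace_mul_sym)
  then have 2: "Re (trace (minv Q ** P)) =
      (\<Sum>i\<in>UNIV. \<Sum>j\<in>UNIV. (cmod ((adj U ** V) $ i $ j))\<^sup>2 * exp (m i - k j))"
    using log_spectral_minv(1)[OF assms(2)] assms(1)
    unfolding log_spectral_def using trace_unitary_diag_mult[OF U V]
    by (simp flip: exp_add)
  have 3: "(\<Sum>i\<in>UNIV. \<Sum>j\<in>UNIV. (cmod ((adj U ** V) $ i $ j))\<^sup>2 * 2) = 2 * of_nat CARD('a)"
    using double_sum_weights(1)[OF W, of "\<lambda>_. 2"] by simp
  show ?thesis unfolding trace_gap_def 1 2 3[symmetric]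
    by (simp add: algebra_simps sum.distrib sum_subtractf)
qed

text \<open>The inverse of the congruence is \<open>N' ** minv P ** adj N'\<close>; the inner
  factors cancel, and cyclicity of the trace removes the outer ones.\<close>

lemma trace_gap_congruence:
  assumes "hpd P" "hpd Q" "invertible N"
  shows "trace_gap (adj N ** P ** N) (adj N ** Q ** N) = trace_gap P Q"
proof -
  obtain N' where N': "N ** N' = mat 1" "N' ** N = mat 1"
    using assms(3) unfolding invertible_def by blast
  have aN': "adj N' ** adj N = mat 1" "adj N ** adj N' = mat 1"
    using N' by (metis adj_mult adj_mat_1)+
  have *: "trace (minv (adj N ** P ** N) ** (adj N ** Q ** N)) = trace (minv P ** Q)"
    if P: "hpd P" for P Q
  proof -
    have "(adj N ** P ** N) ** (N' ** minv P ** adj N') = adj N ** P ** (N ** N') ** minv P ** adj N'"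
      by (simp add: matrix_mul_assoc)
    also have "\<dots> = adj N ** (P ** minv P) ** adj N'"
      by (simp add: N' matrix_mul_assoc)
    finally have "minv (adj N ** P ** N) = N' ** minv P ** adj N'"
      by (intro minv_eq) (simp add: hpd_minv[OF P] aN')
    then have "minv (adj N ** P ** N) ** (adj N ** Q ** N) = N' ** minv P ** (adj N' ** adj N) ** Q ** N"
      by (simp add: matrix_mul_assoc)
    also have "\<dots> = N' ** (minv P ** Q ** N)" by (simp add: aN' matrix_mul_assoc)
    finally have "trace (minv (adj N ** P ** N) ** (adj N ** Q ** N)) = trace ((minv P ** Q ** N) ** N')"
      using trace_mul_sym by metis
    also have "(minv P ** Q ** N) ** N' = minv P ** Q ** (N ** N')" by (simp add: matrix_mul_assoc)
    finally show ?thesis by (simp add: N')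
  qed
  show ?thesis unfolding trace_gap_def using *[OF assms(1)] *[OF assms(2)] by simp
qed

text \<open>The difference of the two sides and its first derivative vanish at 0, and its second
  derivative is the square of \<open>exp (s/2) - exp (- (s/2))\<close>. Evenness in \<open>x\<close>
  reduces the claim to \<open>x \<ge> 0\<close>.\<close>

lemma square_le_exp_gap: "(x::real)\<^sup>2 \<le> exp x + exp (- x) - 2"
proof -
  have "x\<^sup>2 \<le> exp x + exp (- x) - 2" if "x \<ge> 0" for x :: real
  proof -
    define f where "f x = exp x + exp (- x) - 2 - x\<^sup>2" for x :: real
    have e: "exp t - exp (- t) - 2 * t \<ge> 0" if "t \<ge> 0" for t :: real
    proof -
      have "exp (0::real) - exp (- 0) - 2 * 0 \<le> exp t - exp (- t) - 2 * t"
      proof (rule DERIV_nonneg_imp_nondecreasing[OF that])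
        fix s :: real
        have "exp s + exp (- s) - 2 = (exp (s/2) - exp (-(s/2)))\<^sup>2"
          by (simp add: power2_diff flip: exp_double) (simp flip: exp_add)
        then have "exp s + exp (- s) - 2 \<ge> 0" by simp
        moreover have "((\<lambda>s. exp s - exp (- s) - 2 * s) has_real_derivative exp s + exp (- s) - 2) (at s)"
          by (auto intro!: derivative_eq_intros)
        ultimately show "\<exists>y. ((\<lambda>s. exp s - exp (- s) - 2 * s) has_real_derivative y) (at s) \<and> 0 \<le> y" by blast
      qed
      then show ?thesis by simp
    qed
    have "f 0 \<le> f x"
    proof (rule DERIV_nonneg_imp_nondecreasing[OF that])
      fix s :: real assume "0 \<le> s"
      then have "exp s - exp (- s) - 2 * s \<ge> 0" using e by simp
      moreover have "(f has_real_derivative exp s - exp (- s) - 2 * s) (at s)"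
        unfolding f_def by (auto intro!: derivative_eq_intros)
      ultimately show "\<exists>y. (f has_real_derivative y) (at s) \<and> 0 \<le> y" by blast
    qed
    then show ?thesis by (simp add: f_def)
  qed
  from this[of x] this[of "- x"] show ?thesis by (cases "x \<ge> 0") auto
qed

lemma lognorm_le_trace_gap:
  assumes "hpd P" "hpd Q"
  shows "lognorm Q \<le> lognorm P + sqrt (trace_gap P Q)"
proof -
  obtain U m where P: "log_spectral U m P" using assms hpd_log_spectral by blast
  obtain V k where Q: "log_spectral V k Q" using assms hpd_log_spectral by blast
  \<comment> \<open>The modulus itself, not its square: \<open>L2_set\<close> squares its
    summands.\<close>
  define w where "w i j = cmod ((adj U ** V) $ i $ j)" for i j
  have W: "unitary (adj U ** V)"
    using P Q unfolding log_spectral_def by (simp add: unitary_mult unitary_adj)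
  let ?A = "UNIV \<times> UNIV :: ('a \<times> 'a) set"
  have L2: "L2_set (\<lambda>(i,j). w i j * f i j) ?A = sqrt (\<Sum>i\<in>UNIV. \<Sum>j\<in>UNIV. (w i j)\<^sup>2 * (f i j)\<^sup>2)" for f
    by (simp add: L2_set_def sum.cartesian_product case_prod_beta' power_mult_distrib)
  have "lognorm Q = L2_set (\<lambda>(i,j). w i j * k j) ?A"
    unfolding L2 lognorm_eq[OF Q] unfolding w_def double_sum_weights(2)[OF W, of "\<lambda>j. (k j)\<^sup>2"] ..
  also have "(\<lambda>(i,j). w i j * k j) = (\<lambda>x. (\<lambda>(i,j). w i j * m i) x + (\<lambda>(i,j). w i j * (k j - m i)) x)"
    by (auto simp: algebra_simps)
  also have "L2_set \<dots> ?A \<le> L2_set (\<lambda>(i,j). w i j * m i) ?A + L2_set (\<lambda>(i,j). w i j * (k j - m i)) ?A"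
    by (rule L2_set_triangle_ineq)
  also have "L2_set (\<lambda>(i,j). w i j * m i) ?A = lognorm P"
    unfolding L2 lognorm_eq[OF P] unfolding w_def double_sum_weights(1)[OF W, of "\<lambda>j. (m j)\<^sup>2"] ..
  also have "L2_set (\<lambda>(i,j). w i j * (k j - m i)) ?A \<le> sqrt (trace_gap P Q)"
    unfolding L2 trace_gap_eq[OF P Q] w_def[symmetric]
    using square_le_exp_gap by (intro real_sqrt_le_mono sum_mono mult_left_mono) (smt (verit), simp)
  finally show ?thesis by simp
qed

lemma hpd_cdiag:
  assumes "\<And>i. l i > 0"
  shows "hpd (cdiag l)"
  using hpd_congruence[of "mat 1" l] assms by (simp add: invertible_unitary unitary_mat_1)

lemma log_spectral_cdiag: "log_spectral (mat 1) m (cdiag (\<lambda>i. exp (m i)))"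
  by (simp add: log_spectral_def unitary_mat_1)

lemma log_spectral_mat_1: "unitary U \<Longrightarrow> log_spectral U (\<lambda>_. 0) (mat 1)"
  by (simp add: log_spectral_def cdiag_one unitaryD)

lemma hpd_mat_1: "hpd (mat 1)"
  using log_spectral_mat_1[OF unitary_mat_1] log_spectral_hpd by blast

lemma trace_gap_mat_1:
  fixes P :: "'n::finite cmat"
  assumes "log_spectral U m P"
  shows "trace_gap (mat 1) P = (\<Sum>i\<in>UNIV. exp (m i) + exp (- m i) - 2)"
proof -
  have U: "unitary U" using assms by (simp add: log_spectral_def)
  have "trace_gap (mat 1) P = (\<Sum>i\<in>UNIV. \<Sum>j\<in>UNIV. (cmod ((mat 1 :: 'n cmat) $ i $ j))\<^sup>2 *
       (exp (m j - 0) + exp (0 - m j) - 2))"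
    unfolding trace_gap_eq[OF log_spectral_mat_1[OF U] assms] unitaryD(1)[OF U] ..
  also have "\<dots> = (\<Sum>i\<in>UNIV. exp (m i) + exp (- m i) - 2)"
    using double_sum_weights(2)[OF unitary_mat_1, of "\<lambda>j. exp (m j) + exp (- m j) - 2"] by simp
  finally show ?thesis .
qed

text \<open>By congruence invariance the gap between \<open>adj N ** N\<close> and the new point
  equals the gap between the identity and the diagonal factor.\<close>

lemma lognorm_congruence_step:
  assumes "invertible N"
  shows "lognorm (adj N ** cdiag (\<lambda>i. exp (d i)) ** N)
    \<le> lognorm (adj N ** N) + sqrt (\<Sum>i\<in>UNIV. exp (d i) + exp (- d i) - 2)"
  using lognorm_le_trace_gap[OF hpd_congruence_hpd[OF hpd_mat_1 assms]
      hpd_congruence_hpd[OF hpd_cdiag[of "\<lambda>i. exp (d i)"] assms]]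
    trace_gap_congruence[OF hpd_mat_1 hpd_cdiag[of "\<lambda>i. exp (d i)"] assms]
    trace_gap_mat_1[OF log_spectral_cdiag[of d]]
  by simp

text \<open>One step costs the root of a sum whose terms \<open>2 * cosh (d i) - 2\<close> exceed
  \<open>(d i)^2\<close> only in fourth order; cutting the path into \<open>n\<close> equal steps
  makes this excess disappear in the limit.\<close>

lemma lognorm_congruence:
  fixes N :: "'n::finite cmat"
  assumes "invertible N"
  shows "lognorm (adj N ** cdiag (\<lambda>i. exp (d i)) ** N)
    \<le> lognorm (adj N ** N) + sqrt (\<Sum>i\<in>UNIV. (d i)\<^sup>2)"
proof -
  define s where "s n = sqrt (\<Sum>i\<in>UNIV. exp (d i / real n) + exp (- (d i / real n)) - 2)" for n :: nat
  have steps: "lognorm (adj N ** cdiag (\<lambda>i. exp (j * (d i / real n))) ** N)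
      \<le> lognorm (adj N ** N) + j * s n" for n j :: nat
  proof (induction j)
    case 0
    show ?case by (simp add: cdiag_one)
  next
    case (Suc j)
    \<comment> \<open>Half of the exponent reached after \<open>j\<close> steps, so that with
      \<open>D ** N\<close> as new base the previous point becomes
      \<open>adj (D ** N) ** (D ** N)\<close>.\<close>
    define D where "D = (cdiag (\<lambda>i. exp (j * (d i / real n) / 2)) :: 'n cmat)"
    have "invertible D"
      unfolding D_def invertible_def
      by (rule exI[of _ "cdiag (\<lambda>i. exp (- (j * (d i / real n) / 2)))"])
         (simp add: cdiag_mult cdiag_one flip: exp_add)
    then have inv: "invertible (D ** N)" using assms by (rule invertible_mult)
    have "adj (D ** N) ** (D ** N) = adj N ** (D ** D) ** N"
      by (simp add: D_def adj_mult matrix_mul_assoc)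
    then have 1: "adj (D ** N) ** (D ** N) = adj N ** cdiag (\<lambda>i. exp (j * (d i / real n))) ** N"
      by (simp add: D_def cdiag_mult flip: exp_add)
    have "adj (D ** N) ** cdiag (\<lambda>i. exp (d i / real n)) ** (D ** N)
        = adj N ** (D ** cdiag (\<lambda>i. exp (d i / real n)) ** D) ** N"
      by (simp add: D_def adj_mult matrix_mul_assoc)
    also have "D ** cdiag (\<lambda>i. exp (d i / real n)) ** D = cdiag (\<lambda>i. exp (real (Suc j) * (d i / real n)))"
      by (simp add: D_def cdiag_mult algebra_simps add_divide_distrib flip: exp_add)
    finally have "lognorm (adj N ** cdiag (\<lambda>i. exp (real (Suc j) * (d i / real n))) ** N)
        \<le> lognorm (adj N ** cdiag (\<lambda>i. exp (j * (d i / real n))) ** N) + s n"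
      using lognorm_congruence_step[OF inv, of "\<lambda>i. d i / real n"] unfolding 1 s_def by simp
    also have "\<dots> \<le> lognorm (adj N ** N) + real (Suc j) * s n"
      using Suc.IH by (simp add: algebra_simps)
    finally show ?case .
  qed
  \<comment> \<open>Taking \<open>j = n\<close> gives back \<open>d i\<close> only for positive
    \<open>n\<close>, as division by zero yields 0.\<close>
  have le: "lognorm (adj N ** cdiag (\<lambda>i. exp (d i)) ** N) \<le> lognorm (adj N ** N) + n * s n" if "n > 0" for n :: nat
    using steps[of n n] that by simp
  have lim1: "(\<lambda>n. (real n)\<^sup>2 * (exp (x / real n) + exp (- (x / real n)) - 2)) \<longlonglongrightarrow> x\<^sup>2" for x :: real
    by (cases x "0::real" rule: linorder_cases) (simp_all, (real_asymp simp: power2_eq_square)+)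
  have "(\<lambda>n. sqrt (\<Sum>i\<in>UNIV. (real n)\<^sup>2 * (exp (d i / real n) + exp (- (d i / real n)) - 2)))
      \<longlonglongrightarrow> sqrt (\<Sum>i\<in>UNIV. (d i)\<^sup>2)"
    by (intro tendsto_intros lim1)
  moreover have "sqrt (\<Sum>i\<in>UNIV. (real n)\<^sup>2 * (exp (d i / real n) + exp (- (d i / real n)) - 2)) = n * s n" for n
    unfolding s_def by (simp add: real_sqrt_mult flip: sum_distrib_left)
  ultimately have "(\<lambda>n. lognorm (adj N ** N) + n * s n)
      \<longlonglongrightarrow> lognorm (adj N ** N) + sqrt (\<Sum>i\<in>UNIV. (d i)\<^sup>2)"
    by (intro tendsto_intros) simp
  then show ?thesis
    by (rule LIMSEQ_le_const) (use le in \<open>auto intro!: exI[of _ 1]\<close>)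
qed

section \<open>Metric properties of \<open>dR\<close>\<close>

lemma dR_eq: "hpd p \<Longrightarrow> dR p q = lognorm (minv (hpd_sqrt p) ** q ** minv (hpd_sqrt p))"
  by (simp add: dR_def cong_act_def minv_hpd_sqrt)

lemma hpd_whiten:
  assumes "hpd p" "hpd q"
  shows "hpd (minv (hpd_sqrt p) ** q ** minv (hpd_sqrt p))"
  using hpd_congruence_hpd[OF assms(2) minv_hpd_sqrt(2)[OF assms(1)]] minv_hpd_sqrt(1)[OF assms(1)] by simp

lemma dR_nonneg: "dR p q \<ge> 0"
  by (simp add: dR_def frob_nonneg)

lemma dR_mat_1: "dR (mat 1) q = lognorm q" for q :: "'n::finite cmat"
proof -
  have "log_spectral (mat 1) (\<lambda>_. 0) (mat 1 :: 'n cmat)"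
    by (rule log_spectral_mat_1[OF unitary_mat_1])
  from log_spectral_hpd_sqrt(1)[OF this] have "hpd_sqrt (mat 1 :: 'n cmat) = mat 1"
    by (simp add: log_spectral_def cdiag_one)
  moreover have "minv (mat 1 :: 'n cmat) = mat 1" by (rule minv_eq) simp
  ultimately show ?thesis by (simp add: dR_eq hpd_mat_1)
qed

lemma hpd_sqrt_square:
  assumes "hpd A"
  shows "hpd_sqrt A ** hpd_sqrt A = A" "adj (hpd_sqrt A) = hpd_sqrt A"
  using assms hpd_log_spectral log_spectral_hpd_sqrt log_spectral_hpd hpd_adj by metis+

text \<open>After whitening with \<open>A\<close>, the points \<open>B\<close> and \<open>C\<close>
  become \<open>adj N ** N\<close> and \<open>adj N ** cdiag (\<lambda>i. exp (d i)) ** N\<close>,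
  where the norm of \<open>d\<close> is the distance from \<open>B\<close> to \<open>C\<close>;
  \<open>lognorm_congruence\<close> then is the triangle inequality.\<close>

lemma dR_triangle:
  assumes A: "hpd A" and B: "hpd B" and C: "hpd C"
  shows "dR A C \<le> dR A B + dR B C"
proof -
  define a b s where "a = minv (hpd_sqrt A)" and "b = minv (hpd_sqrt B)" and "s = hpd_sqrt B"
  note a = minv_hpd_sqrt[OF A, folded a_def] and b = minv_hpd_sqrt[OF B, folded b_def s_def]
  note s = hpd_sqrt_square[OF B, folded s_def]
  obtain U d where Ud: "log_spectral U d (b ** C ** b)"
    using hpd_log_spectral hpd_whiten[OF B C] unfolding b_def by blast
  then have U: "unitary U" and bCb: "b ** C ** b = U ** cdiag (\<lambda>i. exp (d i)) ** adj U"
    by (auto simp: log_spectral_def)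
  define N where "N = adj U ** s ** a"
  have "invertible s" using b(4,5) unfolding invertible_def by blast
  then have inv: "invertible N"
    unfolding N_def by (intro invertible_mult invertible_unitary[OF unitary_adj[OF U]] a)
  have adjN: "adj N = a ** s ** U"
    by (simp add: N_def adj_mult a s matrix_mul_assoc)
  have "adj N ** N = a ** s ** (U ** adj U) ** s ** a"
    unfolding adjN by (simp add: N_def matrix_mul_assoc)
  also have "\<dots> = a ** (s ** s) ** a"
    by (simp add: unitaryD[OF U] matrix_mul_assoc)
  finally have NN: "adj N ** N = a ** B ** a" by (simp add: s)
  have "adj N ** cdiag (\<lambda>i. exp (d i)) ** N = a ** s ** (b ** C ** b) ** s ** a"
    unfolding adjN bCb by (simp add: N_def matrix_mul_assoc)
  also have "\<dots> = a ** (s ** b) ** C ** (b ** s) ** a"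
    by (simp add: matrix_mul_assoc)
  finally have NCN: "adj N ** cdiag (\<lambda>i. exp (d i)) ** N = a ** C ** a" by (simp add: b)
  show ?thesis
    using lognorm_congruence[OF inv, of d] lognorm_eq[OF Ud] unfolding NN NCN
    by (simp add: dR_eq A B a_def b_def)
qed

text \<open>With \<open>N = s ** a\<close>, the product \<open>adj N ** N\<close> is
  \<open>a ** B ** a\<close>, while \<open>N ** adj N\<close> has the same eigenvalues and the
  inverse \<open>b ** A ** b\<close>. Inversion only flips the signs of the log-eigenvalues, so the
  norms agree.\<close>

lemma dR_commute:
  assumes A: "hpd A" and B: "hpd B"
  shows "dR A B = dR B A"
proof -
  define a r b s where "a = minv (hpd_sqrt A)" and "r = hpd_sqrt A"
    and "b = minv (hpd_sqrt B)" and "s = hpd_sqrt B"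
  note a = minv_hpd_sqrt[OF A, folded a_def r_def] and b = minv_hpd_sqrt[OF B, folded b_def s_def]
  note r = hpd_sqrt_square[OF A, folded r_def]
  note s = hpd_sqrt_square[OF B, folded s_def]
  obtain U m where Um: "log_spectral U m (a ** B ** a)"
    using hpd_log_spectral hpd_whiten[OF A B] unfolding a_def by blast
  then have U: "unitary U" and aBa: "a ** B ** a = U ** cdiag (\<lambda>i. exp (m i)) ** adj U"
    by (auto simp: log_spectral_def)
  define E F where "E = cdiag (\<lambda>i. exp (- (m i / 2)))" and "F = cdiag (\<lambda>i. exp (m i))"
  have E: "adj E = E" by (simp add: E_def)
  have EFE: "E ** F ** E = mat 1"
    unfolding E_def F_def cdiag_mult by (simp add: cdiag_one flip: exp_add)
  have EE: "E ** F ** E = E ** E ** F" "E ** F ** E = F ** E ** E"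
    unfolding E_def F_def cdiag_mult by (simp_all flip: exp_add)
  define N where "N = s ** a"
  have adjN: "adj N = a ** s"
    by (simp add: N_def adj_mult a s)
  \<comment> \<open>\<open>N\<close> maps the eigenvectors of \<open>adj N ** N\<close> to those of
    \<open>N ** adj N\<close>; the factor \<open>E\<close> normalizes the images.\<close>
  define V where "V = N ** U ** E"
  have adjV: "adj V = E ** adj U ** a ** s"
    by (simp add: V_def adj_mult adjN E matrix_mul_assoc)
  have "adj V ** V = E ** adj U ** (a ** (s ** s) ** a) ** U ** E"
    unfolding adjV by (simp add: V_def N_def matrix_mul_assoc)
  also have "\<dots> = E ** (adj U ** U) ** F ** (adj U ** U) ** E"
    unfolding s aBa F_def by (simp add: matrix_mul_assoc)
  finally have V: "unitary V" by (simp add: unitaryD[OF U] EFE unitary_def)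
  have "V ** F ** adj V = N ** U ** (E ** F ** E) ** adj U ** adj N"
    unfolding adjV adjN by (simp add: V_def matrix_mul_assoc)
  also have "\<dots> = N ** (U ** adj U) ** adj N"
    unfolding EFE by (simp add: matrix_mul_assoc)
  finally have Vm: "log_spectral V m (N ** adj N)"
    using V by (simp add: unitaryD[OF U] log_spectral_def F_def)
  have "N ** adj N ** (b ** A ** b) = s ** a ** a ** (s ** b) ** (r ** r) ** b"
    unfolding adjN r by (simp add: N_def matrix_mul_assoc)
  also have "\<dots> = s ** a ** (a ** r) ** r ** b"
    by (simp add: b matrix_mul_assoc)
  also have "\<dots> = s ** a ** r ** b"
    by (simp only: a matrix_mul_rid)
  also have "\<dots> = s ** (a ** r) ** b"
    by (simp only: matrix_mul_assoc)
  finally have "minv (N ** adj N) = b ** A ** b"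
    by (intro minv_eq) (simp add: a b)
  then have "lognorm (b ** A ** b) = lognorm (a ** B ** a)"
    using lognorm_eq[OF log_spectral_minv(1)[OF Vm]] lognorm_eq[OF Um] by simp
  then show ?thesis by (simp add: dR_eq A B a_def b_def)
qed

section \<open>Sequential compactness of bounded sets\<close>

lemma dR_squared_le_trace_gap:
  assumes p: "hpd p" and q: "hpd q"
  shows "(dR p q)\<^sup>2 \<le> trace_gap p q"
proof -
  define a where "a = minv (hpd_sqrt p)"
  note a = minv_hpd_sqrt[OF p, folded a_def]
  obtain U m where Um: "log_spectral U m (a ** q ** a)"
    using hpd_log_spectral hpd_whiten[OF p q] unfolding a_def by blast
  have "(dR p q)\<^sup>2 = (\<Sum>i\<in>UNIV. (m i)\<^sup>2)"
    unfolding dR_eq[OF p] a_def[symmetric] lognorm_eq[OF Um] by (simp add: sum_nonneg)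
  \<comment> \<open>Whitening by \<open>a\<close> sends \<open>p\<close> to the identity, where the
    gap is a plain sum over the eigenvalues.\<close>
  also have "\<dots> \<le> trace_gap (mat 1) (a ** q ** a)"
    unfolding trace_gap_mat_1[OF Um] by (intro sum_mono square_le_exp_gap)
  also have "\<dots> = trace_gap p q"
    using trace_gap_congruence[OF p q a(2)] by (simp add: a)
  finally show ?thesis .
qed

text \<open>Eigenbases range over a compact group and log-eigenvalues over a ball, so both converge
  along a subsequence. Limits of log-eigenvalues are finite, so the limit point is again positive
  definite, and \<open>trace_gap\<close> controls the distance to it.\<close>

lemma dR_bounded_sequence_convergent:
  fixes ys :: "nat \<Rightarrow> 'n::finite cmat"
  assumes hpd: "\<And>n. hpd (ys n)" and bd: "\<And>n. lognorm (ys n) \<le> R"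
  obtains y r where "hpd y" "strict_mono r" "(\<lambda>n. dR y (ys (r n))) \<longlonglongrightarrow> 0"
proof -
  have "\<exists>U m. log_spectral U m (ys n)" for n
    using hpd hpd_log_spectral by blast
  then obtain U m where Um: "\<And>n. log_spectral (U n) (m n) (ys n)" by metis
  define M where "M n = (\<chi> i. m n i)" for n
  have comp: "compact ({U :: 'n cmat. unitary U} \<times> cball (0 :: real ^ 'n) R)"
    by (intro compact_Times compact_unitary compact_cball)
  have mem: "(U n, M n) \<in> {U. unitary U} \<times> cball 0 R" for n
  proof -
    have "norm (M n) = lognorm (ys n)"
      unfolding lognorm_eq[OF Um] by (simp add: M_def norm_vec_def L2_set_def)
    then show ?thesis using Um[of n] bd[of n] unfolding log_spectral_def by simp
  qed
  obtain X r where X: "X \<in> {U. unitary U} \<times> cball 0 R" and r: "strict_mono r"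
    and lim: "((\<lambda>n. (U n, M n)) \<circ> r) \<longlonglongrightarrow> X"
    using seq_compactE[OF compact_imp_seq_compact[OF comp], of "\<lambda>n. (U n, M n)"] mem by blast
  obtain V k where Xeq: "X = (V, k)" by (cases X)
  have V: "unitary V" using X Xeq by simp
  define y where "y = V ** cdiag (\<lambda>i. exp (k $ i)) ** adj V"
  have Vk: "log_spectral V (\<lambda>i. k $ i) y" using V by (simp add: log_spectral_def y_def)
  have hy: "hpd y" using log_spectral_hpd[OF Vk] .
  have limU: "(\<lambda>n. U (r n)) \<longlonglongrightarrow> V" and limM: "(\<lambda>n. M (r n)) \<longlonglongrightarrow> k"
    using tendsto_fst[OF lim] tendsto_snd[OF lim] by (simp_all add: o_def Xeq)
  have limm: "(\<lambda>n. m (r n) i) \<longlonglongrightarrow> k $ i" for i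
    using tendsto_vec_nth[OF limM, of i] by (simp add: M_def)
  have limW: "(\<lambda>n. (adj V ** U (r n)) $ i $ j) \<longlonglongrightarrow> (adj V ** V) $ i $ j" for i j
    unfolding matrix_matrix_mult_def by (simp, intro tendsto_intros limU)
  have "(\<lambda>n. trace_gap y (ys (r n))) \<longlonglongrightarrow>
      (\<Sum>i\<in>UNIV. \<Sum>j\<in>UNIV. (cmod ((adj V ** V) $ i $ j))\<^sup>2 * (exp (k $ j - k $ i) + exp (k $ i - k $ j) - 2))"
    unfolding trace_gap_eq[OF Vk Um] by (intro tendsto_intros limW limm)
  also have "(\<Sum>i\<in>UNIV. \<Sum>j\<in>UNIV. (cmod ((adj V ** V) $ i $ j))\<^sup>2 * (exp (k $ j - k $ i) + exp (k $ i - k $ j) - 2)) = 0"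
    unfolding unitaryD(1)[OF V] by (intro sum.neutral ballI) (simp add: mat_def)
  finally have "(\<lambda>n. sqrt (trace_gap y (ys (r n)))) \<longlonglongrightarrow> 0"
    using tendsto_real_sqrt by fastforce
  then have "(\<lambda>n. dR y (ys (r n))) \<longlonglongrightarrow> 0"
  proof (rule tendsto_sandwich[OF _ _ tendsto_const, rotated 2])
    show "\<forall>\<^sub>F n in sequentially. 0 \<le> dR y (ys (r n))" by (simp add: dR_nonneg)
    show "\<forall>\<^sub>F n in sequentially. dR y (ys (r n)) \<le> sqrt (trace_gap y (ys (r n)))"
      using dR_squared_le_trace_gap[OF hy hpd] by (simp add: real_le_rsqrt)
  qed
  then show ?thesis using that hy r by blast
qed

section \<open>Mean distances and depths\<close>

lemma HPD_iff: "p \<in> HPD \<longleftrightarrow> hpd p"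
  by (simp add: HPD_def)

lemma space_HPD_borel: "space HPD_borel = HPD"
  by (simp add: HPD_borel_def dR_open_def space_measure_of_conv)

lemma dR_open_sets: "dR_open U \<Longrightarrow> U \<in> sets HPD_borel"
  unfolding HPD_borel_def by (subst sets_measure_of) (auto simp: dR_open_def)

lemma borel_prob_HPDD:
  assumes "borel_prob_HPD \<nu>"
  shows "prob_space \<nu>" "space \<nu> = HPD" "sets \<nu> = sets HPD_borel"
  using assms sets_eq_imp_space_eq[of \<nu> HPD_borel]
  by (auto simp: borel_prob_HPD_def space_HPD_borel)

lemma dR_diff_le:
  assumes "hpd x" "hpd y" "hpd z"
  shows "\<bar>dR y x - dR z x\<bar> \<le> dR y z" "\<bar>dR x y - dR x z\<bar> \<le> dR y z"
  using dR_triangle[of y z x] dR_triangle[of z y x] dR_commute[of y z] dR_commute[of x y] dR_commute[of x z] assms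
  by auto

text \<open>Superlevel sets of a continuous function are \<open>dR_open\<close>, and such sets
  generate the sigma-algebra.\<close>

lemma dR_continuous_measurable:
  assumes "borel_prob_HPD \<nu>" "dR_continuous \<phi>"
  shows "\<phi> \<in> borel_measurable \<nu>"
proof (rule borel_measurableI_greater)
  fix a
  have "dR_open {x \<in> HPD. a < \<phi> x}"
    unfolding dR_open_def
  proof (intro conjI ballI)
    fix x assume x: "x \<in> {x \<in> HPD. a < \<phi> x}"
    then obtain d where "d > 0" and "\<And>y. y \<in> HPD \<Longrightarrow> dR x y < d \<Longrightarrow> \<bar>\<phi> y - \<phi> x\<bar> < \<phi> x - a"
      using assms(2) unfolding dR_continuous_def by (metis (no_types, lifting) diff_gt_0_iff_gt mem_Collect_eq)
    then show "\<exists>e>0. {y \<in> HPD. dR x y < e} \<subseteq> {x \<in> HPD. a < \<phi> x}"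
      by (intro exI[of _ d]) force
  qed auto
  then show "{x \<in> space \<nu>. a < \<phi> x} \<in> sets \<nu>"
    using dR_open_sets borel_prob_HPDD[OF assms(1)] by auto
qed

lemma dR_continuousI:
  assumes "\<And>x x'. hpd x \<Longrightarrow> hpd x' \<Longrightarrow> \<bar>\<phi> x' - \<phi> x\<bar> \<le> dR x x'"
  shows "dR_continuous \<phi>"
  unfolding dR_continuous_def
proof (intro ballI allI impI)
  fix x :: "'a cmat" and e :: real assume "x \<in> HPD" "e > 0"
  then show "\<exists>d>0. \<forall>y\<in>HPD. dR x y < d \<longrightarrow> \<bar>\<phi> y - \<phi> x\<bar> < e"
    using assms by (intro exI[of _ e]) (fastforce simp: HPD_iff)
qed

lemma dR_continuous_dR:
  assumes "hpd y"
  shows "dR_continuous (dR y)"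
  using dR_diff_le(2)[OF assms] by (intro dR_continuousI) (simp add: abs_minus_commute)

text \<open>Truncated distances are the bounded continuous test functions to which weak convergence
  is applied.\<close>

lemma dR_continuous_min:
  assumes "hpd y"
  shows "dR_continuous (\<lambda>x. min (dR y x) K)"
proof (rule dR_continuousI)
  fix x x' :: "'a cmat" assume "hpd x" "hpd x'"
  then show "\<bar>min (dR y x') K - min (dR y x) K\<bar> \<le> dR x x'"
    using dR_diff_le(2)[OF assms, of x x'] by (auto simp: min_def abs_le_iff)
qed

lemma dR_measurable [measurable]:
  assumes "borel_prob_HPD \<nu>" "hpd y"
  shows "dR y \<in> borel_measurable \<nu>"
  using dR_continuous_measurable dR_continuous_dR assms by blast

text \<open>The integrable function \<open>dR y y0 + dR y0 x\<close> dominates, so a finite first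
  moment moves from one base point to all others.\<close>

lemma integrable_dR:
  assumes \<nu>: "borel_prob_HPD \<nu>" and "hpd y0" "hpd y"
    and fin: "(\<integral>\<^sup>+ x. ennreal (dR y0 x) \<partial>\<nu>) < \<infinity>"
  shows "integrable \<nu> (dR y)"
proof -
  interpret prob_space \<nu> using borel_prob_HPDD(1)[OF \<nu>] .
  have "integrable \<nu> (dR y0)"
    by (rule integrableI_nonneg) (use assms dR_nonneg in \<open>auto intro: dR_measurable\<close>)
  then have "integrable \<nu> (\<lambda>x. dR y y0 + dR y0 x)" by simp
  moreover have "norm (dR y x) \<le> norm (dR y y0 + dR y0 x)" if "x \<in> space \<nu>" for x
    using that dR_triangle[of y y0 x] assms(2,3) dR_nonneg[of y x]
    by (simp add: borel_prob_HPDD(2)[OF \<nu>] HPD_iff)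
  ultimately show ?thesis
    using Bochner_Integration.integrable_bound[OF _ dR_measurable[OF \<nu> assms(3)] AE_I2] by blast
qed

lemma P1_integrable:
  assumes "P1 \<nu>" "hpd y"
  shows "borel_prob_HPD \<nu>" "integrable \<nu> (dR y)"
  using assms integrable_dR[of \<nu> _ y] by (auto simp: P1_def HPD_iff)

lemma GDD_eq_exp:
  assumes "integrable \<nu> (dR y)"
  shows "GDD \<nu> y = exp (- (\<integral>x. dR y x \<partial>\<nu>))"
  using assms nn_integral_eq_integral[OF assms]
  by (simp add: GDD_def dR_nonneg integral_nonneg)

lemma mean_dR_diff_le:
  assumes \<nu>: "borel_prob_HPD \<nu>" and int: "\<And>y. hpd y \<Longrightarrow> integrable \<nu> (dR y)"
    and "hpd y" "hpd z"
  shows "\<bar>(\<integral>x. dR y x \<partial>\<nu>) - (\<integral>x. dR z x \<partial>\<nu>)\<bar> \<le> dR y z"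
proof -
  interpret prob_space \<nu> using borel_prob_HPDD(1)[OF \<nu>] .
  have "\<bar>(\<integral>x. dR y x \<partial>\<nu>) - (\<integral>x. dR z x \<partial>\<nu>)\<bar> = \<bar>\<integral>x. dR y x - dR z x \<partial>\<nu>\<bar>"
    using int assms by simp
  also have "\<dots> \<le> (\<integral>x. \<bar>dR y x - dR z x\<bar> \<partial>\<nu>)" by (rule integral_abs_bound)
  also have "\<dots> \<le> (\<integral>x. dR y z \<partial>\<nu>)"
    using int assms dR_diff_le(1) by (intro integral_mono) (auto simp: borel_prob_HPDD(2)[OF \<nu>] HPD_iff)
  finally show ?thesis by (simp add: prob_space)
qed

text \<open>Integrating the triangle inequality from \<open>z\<close> through \<open>x\<close> to
  \<open>y\<close> over \<open>x\<close> shows that mean distances grow without bound far from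
  \<open>z\<close>. This drives the depth to zero there, at a rate that depends on the measure only
  through its mean distance from \<open>z\<close>.\<close>

lemma mean_dR_ge:
  assumes \<nu>: "borel_prob_HPD \<nu>" and int: "\<And>y. hpd y \<Longrightarrow> integrable \<nu> (dR y)"
    and "hpd y" "hpd z"
  shows "dR z y - (\<integral>x. dR z x \<partial>\<nu>) \<le> (\<integral>x. dR y x \<partial>\<nu>)"
proof -
  interpret prob_space \<nu> using borel_prob_HPDD(1)[OF \<nu>] .
  have "dR z y = (\<integral>x. dR z y \<partial>\<nu>)" by (simp add: prob_space)
  also have "\<dots> \<le> (\<integral>x. dR z x + dR y x \<partial>\<nu>)"
  proof (rule integral_mono)
    fix x assume "x \<in> space \<nu>"
    then have "hpd x" by (simp add: borel_prob_HPDD(2)[OF \<nu>] HPD_iff)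
    then show "dR z y \<le> dR z x + dR y x"
      using dR_triangle[of z x y] dR_commute[of x y] assms by simp
  qed (use int assms in auto)
  also have "\<dots> = (\<integral>x. dR z x \<partial>\<nu>) + (\<integral>x. dR y x \<partial>\<nu>)" using int assms by simp
  finally show ?thesis by simp
qed

section \<open>Uniform integrability and convergence of mean distances\<close>

lemma unif_integrable_tails:
  assumes "unif_integrable \<nu>s"
  obtains y0 where "hpd y0"
    "\<And>\<epsilon>. \<epsilon> > 0 \<Longrightarrow> \<exists>K0. \<forall>K\<ge>K0. \<forall>n. (\<integral>\<^sup>+ x. ennreal (dR y0 x * indicator {x. dR y0 x > K} x) \<partial>(\<nu>s n)) \<le> ennreal \<epsilon>"
proof -
  obtain y0 where y0: "hpd y0" and
    lim: "((\<lambda>K::real. SUP n. \<integral>\<^sup>+ x. ennreal (dR y0 x * indicator {x. dR y0 x > K} x) \<partial>(\<nu>s n)) \<longlongrightarrow> 0) at_top"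
    using assms by (auto simp: unif_integrable_def HPD_iff)
  have "\<exists>K0. \<forall>K\<ge>K0. \<forall>n. (\<integral>\<^sup>+ x. ennreal (dR y0 x * indicator {x. dR y0 x > K} x) \<partial>(\<nu>s n)) \<le> ennreal \<epsilon>"
    if "\<epsilon> > 0" for \<epsilon>
  proof -
    have "\<forall>\<^sub>F K in at_top. (SUP n. \<integral>\<^sup>+ x. ennreal (dR y0 x * indicator {x. dR y0 x > K} x) \<partial>(\<nu>s n)) < ennreal \<epsilon>"
      using order_tendstoD(2)[OF lim, of "ennreal \<epsilon>"] that by simp
    then obtain K0 where K0: "\<And>K. K \<ge> K0 \<Longrightarrow> (SUP n. \<integral>\<^sup>+ x. ennreal (dR y0 x * indicator {x. dR y0 x > K} x) \<partial>(\<nu>s n)) < ennreal \<epsilon>"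
      by (auto simp: eventually_at_top_linorder)
    have "(\<integral>\<^sup>+ x. ennreal (dR y0 x * indicator {x. dR y0 x > K} x) \<partial>(\<nu>s n)) \<le> ennreal \<epsilon>" if "K \<ge> K0" for K n
      using SUP_lessD[OF K0[OF that], of n] by simp
    then show ?thesis by blast
  qed
  then show ?thesis using that y0 by blast
qed

text \<open>One tail bound suffices: up to the level \<open>K\<close> the distance is at most
  \<open>\<bar>K\<bar>\<close> (the obtained \<open>K\<close> might be negative), and beyond it the
  tail integral is at most 1.\<close>

lemma unif_integrable_integrable:
  assumes ui: "unif_integrable \<nu>s" and \<nu>s: "borel_prob_HPD (\<nu>s n)" and "hpd y"
  shows "integrable (\<nu>s n) (dR y)"
proof -
  interpret prob_space "\<nu>s n" using borel_prob_HPDD(1)[OF \<nu>s] .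
  obtain y0 where y0: "hpd y0" and tails: "\<And>\<epsilon>. \<epsilon> > 0 \<Longrightarrow>
      \<exists>K0. \<forall>K\<ge>K0. \<forall>n. (\<integral>\<^sup>+ x. ennreal (dR y0 x * indicator {x. dR y0 x > K} x) \<partial>(\<nu>s n)) \<le> ennreal \<epsilon>"
    using unif_integrable_tails[OF ui] by blast
  obtain K where K: "(\<integral>\<^sup>+ x. ennreal (dR y0 x * indicator {x. dR y0 x > K} x) \<partial>(\<nu>s n)) \<le> ennreal 1"
    using tails[OF zero_less_one] by blast
  note [measurable] = dR_measurable[OF \<nu>s y0]
  have "(\<integral>\<^sup>+ x. ennreal (dR y0 x) \<partial>(\<nu>s n))
      \<le> (\<integral>\<^sup>+ x. ennreal \<bar>K\<bar> + ennreal (dR y0 x * indicator {x. dR y0 x > K} x) \<partial>(\<nu>s n))"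
    by (intro nn_integral_mono) (auto simp: dR_nonneg indicator_def intro!: ennreal_leI)
  also have "\<dots> = (\<integral>\<^sup>+ x. ennreal \<bar>K\<bar> \<partial>(\<nu>s n)) + (\<integral>\<^sup>+ x. ennreal (dR y0 x * indicator {x. dR y0 x > K} x) \<partial>(\<nu>s n))"
    by (rule nn_integral_add) measurable
  also have "\<dots> \<le> ennreal \<bar>K\<bar> + ennreal 1"
    using K by (simp add: emeasure_space_1)
  also have "\<dots> < \<infinity>" by simp
  finally show ?thesis using integrable_dR[OF \<nu>s y0 assms(3)] by blast
qed

text \<open>Distances are unbounded, so weak convergence is applied to truncations; uniform
  integrability controls the truncation errors for all \<open>\<nu>s n\<close>, and dominated
  convergence that for \<open>\<nu>\<close>.\<close>

lemma mean_dR_pointwise_convergence: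
  assumes \<nu>: "P1 \<nu>" and \<nu>s: "\<And>n. borel_prob_HPD (\<nu>s n)"
    and ui: "unif_integrable \<nu>s" and wc: "weak_conv \<nu>s \<nu>" and y: "hpd y"
  shows "(\<lambda>n. \<integral>x. dR y x \<partial>(\<nu>s n)) \<longlonglongrightarrow> (\<integral>x. dR y x \<partial>\<nu>)"
proof (rule LIMSEQ_I)
  fix r :: real assume "r > 0"
  define \<epsilon> where "\<epsilon> = r / 3"
  have \<epsilon>: "\<epsilon> > 0" using \<open>r > 0\<close> by (simp add: \<epsilon>_def)
  note b = P1_integrable[OF \<nu> y]
  obtain y0 where y0: "hpd y0" and tails: "\<And>\<epsilon>. \<epsilon> > 0 \<Longrightarrow>
      \<exists>K0. \<forall>K\<ge>K0. \<forall>n. (\<integral>\<^sup>+ x. ennreal (dR y0 x * indicator {x. dR y0 x > K} x) \<partial>(\<nu>s n)) \<le> ennreal \<epsilon>"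
    using unif_integrable_tails[OF ui] by blast
  obtain K0 where K0: "\<And>K n. K \<ge> K0 \<Longrightarrow>
      (\<integral>\<^sup>+ x. ennreal (dR y0 x * indicator {x. dR y0 x > K} x) \<partial>(\<nu>s n)) \<le> ennreal \<epsilon>"
    using tails[OF \<epsilon>] by blast
  define a where "a = dR y y0"
  have a: "a \<ge> 0" by (simp add: a_def dR_nonneg)
  have meas: "(\<lambda>x. min (dR y x) K) \<in> borel_measurable \<mu>" if "borel_prob_HPD \<mu>" for \<mu> K
    using dR_continuous_measurable[OF that dR_continuous_min[OF y]] .
  \<comment> \<open>The excess over \<open>K\<close> is nonzero only where
    \<open>dR y0 x > K - a\<close>, and is at most \<open>dR y0 x\<close> there because
    \<open>K \<ge> a\<close>; the shift by \<open>a\<close> thus passes from \<open>y\<close> to the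
    base point of the tail bounds.\<close>
  have trunc: "(\<integral>x. dR y x \<partial>(\<nu>s n)) - (\<integral>x. min (dR y x) K \<partial>(\<nu>s n)) \<in> {0..\<epsilon>}" if K: "K \<ge> max 0 K0 + a" for K n
  proof -
    have int: "integrable (\<nu>s n) (dR y)" by (rule unif_integrable_integrable[OF ui \<nu>s y])
    have intm: "integrable (\<nu>s n) (\<lambda>x. min (dR y x) K)"
      by (rule Bochner_Integration.integrable_bound[OF int meas[OF \<nu>s]])
         (use K a in \<open>auto simp: dR_nonneg abs_of_nonneg\<close>)
    have "ennreal (\<integral>x. dR y x - min (dR y x) K \<partial>(\<nu>s n)) = (\<integral>\<^sup>+x. ennreal (dR y x - min (dR y x) K) \<partial>(\<nu>s n))"
      by (rule nn_integral_eq_integral[symmetric]) (use int intm in auto)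
    also have "\<dots> \<le> (\<integral>\<^sup>+ x. ennreal (dR y0 x * indicator {x. dR y0 x > K - a} x) \<partial>(\<nu>s n))"
    proof (intro nn_integral_mono ennreal_leI)
      fix x assume "x \<in> space (\<nu>s n)"
      then have "hpd x" by (simp add: borel_prob_HPDD(2)[OF \<nu>s] HPD_iff)
      then have "dR y x \<le> a + dR y0 x" using dR_triangle y y0 unfolding a_def by blast
      then show "dR y x - min (dR y x) K \<le> dR y0 x * indicator {x. dR y0 x > K - a} x"
        using K dR_nonneg[of y0 x] by (auto simp: indicator_def min_def)
    qed
    also have "\<dots> \<le> ennreal \<epsilon>" using K by (intro K0) simp
    finally have "(\<integral>x. dR y x - min (dR y x) K \<partial>(\<nu>s n)) \<le> \<epsilon>"
      using \<epsilon> by simp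
    moreover have "0 \<le> (\<integral>x. dR y x - min (dR y x) K \<partial>(\<nu>s n))"
      by (intro Bochner_Integration.integral_nonneg) simp
    ultimately show ?thesis using int intm by simp
  qed
  have "(\<lambda>k. \<integral>x. min (dR y x) (real k) \<partial>\<nu>) \<longlonglongrightarrow> (\<integral>x. dR y x \<partial>\<nu>)"
  proof (rule integral_dominated_convergence[where w = "dR y"])
    show "AE x in \<nu>. (\<lambda>k. min (dR y x) (real k)) \<longlonglongrightarrow> dR y x"
    proof (rule AE_I2)
      fix x
      obtain k0 :: nat where "dR y x \<le> real k0" using real_arch_simple by blast
      then have "\<forall>\<^sub>F k in sequentially. min (dR y x) (real k) = dR y x"
        unfolding eventually_sequentially by (intro exI[of _ k0]) auto
      then show "(\<lambda>k. min (dR y x) (real k)) \<longlonglongrightarrow> dR y x"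
        by (rule tendsto_eventually)
    qed
  qed (use b meas dR_measurable[OF _ y] in \<open>auto simp: dR_nonneg abs_of_nonneg intro!: AE_I2\<close>)
  then have "\<forall>\<^sub>F k in sequentially. \<bar>(\<integral>x. min (dR y x) (real k) \<partial>\<nu>) - (\<integral>x. dR y x \<partial>\<nu>)\<bar> < \<epsilon>"
    using \<epsilon> by (simp add: tendsto_iff dist_real_def)
  moreover have "\<forall>\<^sub>F k in sequentially. real k \<ge> max 0 K0 + a"
    using filterlim_real_sequentially unfolding filterlim_at_top by blast
  ultimately have "\<forall>\<^sub>F k in sequentially. \<bar>(\<integral>x. min (dR y x) (real k) \<partial>\<nu>) - (\<integral>x. dR y x \<partial>\<nu>)\<bar> < \<epsilon> \<and> real k \<ge> max 0 K0 + a"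
    by (rule eventually_conj)
  \<comment> \<open>One level \<open>k\<close> serves the limit measure and, via
    \<open>trunc\<close>, all \<open>n\<close> at once, before weak convergence selects
    \<open>n0\<close>.\<close>
  then obtain k :: nat where k: "\<bar>(\<integral>x. min (dR y x) (real k) \<partial>\<nu>) - (\<integral>x. dR y x \<partial>\<nu>)\<bar> < \<epsilon>"
      "real k \<ge> max 0 K0 + a"
    using eventually_happens'[OF sequentially_bot] by blast
  have "\<forall>x\<in>HPD. \<bar>min (dR y x) (real k)\<bar> \<le> real k"
    by (simp add: dR_nonneg abs_of_nonneg)
  then have "(\<lambda>n. \<integral>x. min (dR y x) (real k) \<partial>(\<nu>s n)) \<longlonglongrightarrow> (\<integral>x. min (dR y x) (real k) \<partial>\<nu>)"
    using wc dR_continuous_min[OF y] unfolding weak_conv_def by blast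
  then obtain n0 where n0: "\<And>n. n \<ge> n0 \<Longrightarrow>
      \<bar>(\<integral>x. min (dR y x) (real k) \<partial>(\<nu>s n)) - (\<integral>x. min (dR y x) (real k) \<partial>\<nu>)\<bar> < \<epsilon>"
    using LIMSEQ_D[OF _ \<epsilon>] by fastforce
  have "norm ((\<integral>x. dR y x \<partial>(\<nu>s n)) - (\<integral>x. dR y x \<partial>\<nu>)) < r" if "n \<ge> n0" for n
    using n0[OF that] trunc[OF k(2), of n] k(1) \<epsilon>_def
    unfolding real_norm_def atLeastAtMost_iff abs_less_iff by linarith
  then show "\<exists>no. \<forall>n\<ge>no. norm ((\<integral>x. dR y x \<partial>(\<nu>s n)) - (\<integral>x. dR y x \<partial>\<nu>)) < r" by blast
qed

section \<open>Uniform convergence of the depths\<close>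

lemma GDD_bounds: "0 \<le> GDD \<nu> y" "GDD \<nu> y \<le> 1"
  by (auto simp: GDD_def Let_def)

lemma exp_minus_diff_le:
  fixes a b :: real
  assumes "0 \<le> a" "0 \<le> b"
  shows "\<bar>exp (- a) - exp (- b)\<bar> \<le> \<bar>a - b\<bar>"
proof -
  have "exp (- s) - exp (- t) \<le> t - s" if "0 \<le> s" "s \<le> t" for s t :: real
  proof -
    have "exp (- s) - exp (- t) = exp (- s) * (1 - exp (- (t - s)))"
      by (simp add: algebra_simps flip: exp_add)
    also have "\<dots> \<le> 1 * (t - s)"
      using that exp_ge_add_one_self[of "- (t - s)"] by (intro mult_mono) (auto simp del: exp_ge_add_one_self)
    finally show ?thesis by simp
  qed
  from this[of a b] this[of b a] show ?thesis
    using assms by (cases "a \<le> b") (auto simp: abs_if)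
qed

text \<open>Points violating convergence stay bounded, since both depths vanish uniformly far away;
  a subsequence then converges to some \<open>z\<close>, where pointwise convergence of the mean
  distances gives the contradiction.\<close>

lemma GDD_diff_along_sequence:
  fixes \<nu> :: "'n::finite cmat measure"
  assumes \<nu>: "P1 \<nu>" and \<nu>s: "\<And>n. borel_prob_HPD (\<nu>s n)"
    and ui: "unif_integrable \<nu>s" and wc: "weak_conv \<nu>s \<nu>" and y: "\<And>n. hpd (y n)"
  shows "(\<lambda>n. \<bar>GDD (\<nu>s n) (y n) - GDD \<nu> (y n)\<bar>) \<longlonglongrightarrow> 0"
proof (rule ccontr)
  let ?e = "\<lambda>n. \<bar>GDD (\<nu>s n) (y n) - GDD \<nu> (y n)\<bar>"
  assume "\<not> ?e \<longlonglongrightarrow> 0"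
  then obtain \<epsilon> where \<epsilon>: "\<epsilon> > 0" and ev: "\<not> (\<forall>\<^sub>F n in sequentially. ?e n < \<epsilon>)"
    by (auto simp: tendsto_iff)
  obtain r :: "nat \<Rightarrow> nat" where r: "strict_mono r" "\<And>k. ?e (r k) \<ge> \<epsilon>"
    using not_eventually_sequentiallyD[OF ev] unfolding not_less by blast
  define I J where "I n y = (\<integral>x. dR y x \<partial>(\<nu>s n))" and "J y = (\<integral>x. dR y x \<partial>\<nu>)" for n y
  have conv: "(\<lambda>n. I n z) \<longlonglongrightarrow> J z" if "hpd z" for z
    unfolding I_def J_def using mean_dR_pointwise_convergence[OF \<nu> \<nu>s ui wc that] .
  note bJ = P1_integrable(1)[OF \<nu> hpd_mat_1]
  note intI = unif_integrable_integrable[OF ui \<nu>s] and intJ = P1_integrable(2)[OF \<nu>]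
  have GI: "GDD (\<nu>s n) z = exp (- I n z)" and GJ: "GDD \<nu> z = exp (- J z)" if "hpd z" for n z
    using GDD_eq_exp[OF intI[OF that]] GDD_eq_exp[OF intJ[OF that]] by (simp_all add: I_def J_def)
  have nonneg: "I n z \<ge> 0" "J z \<ge> 0" for n z
    by (simp_all add: I_def J_def dR_nonneg integral_nonneg)
  obtain C0 where C0: "\<And>n. norm (I n (mat 1)) \<le> C0"
    using convergent_imp_Bseq[OF convergentI[OF conv[OF hpd_mat_1]]] unfolding Bseq_def by blast
  \<comment> \<open>A common bound for the mean distances from the identity; it exists because they
    converge.\<close>
  define C where "C = max C0 (J (mat 1))"
  have C: "I n (mat 1) \<le> C" "J (mat 1) \<le> C" for n
    using C0[of n] by (auto simp: C_def)
  have low: "dR (mat 1) (y n) - I n (mat 1) \<le> I n (y n)" "dR (mat 1) (y n) - J (mat 1) \<le> J (y n)" for n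
    using mean_dR_ge[OF \<nu>s intI y hpd_mat_1] mean_dR_ge[OF bJ intJ y hpd_mat_1]
    unfolding I_def J_def by blast+
  have bd: "lognorm (y (r k)) \<le> C - ln \<epsilon>" for k
  proof -
    have far: "dR (mat 1) (y (r k)) - C \<le> I (r k) (y (r k))" "dR (mat 1) (y (r k)) - C \<le> J (y (r k))"
      using low[of "r k"] C(1)[of "r k"] C(2) by linarith+
    \<comment> \<open>Two positive numbers that differ by at least \<open>\<epsilon>\<close> cannot
      both be smaller than \<open>\<epsilon>\<close>.\<close>
    have "\<epsilon> \<le> max (exp (- I (r k) (y (r k)))) (exp (- J (y (r k))))"
      using r(2)[of k] exp_gt_zero[of "- I (r k) (y (r k))"] exp_gt_zero[of "- J (y (r k))"]
      unfolding GI[OF y] GJ[OF y] by linarith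
    also have "\<dots> \<le> exp (C - dR (mat 1) (y (r k)))" using far by simp
    finally have "ln \<epsilon> \<le> C - dR (mat 1) (y (r k))"
      using \<epsilon> by (metis ln_exp ln_mono exp_gt_zero)
    then show ?thesis by (simp add: dR_mat_1)
  qed
  obtain z s where z: "hpd z" and s: "strict_mono s" and lim: "(\<lambda>n. dR z (y (r (s n)))) \<longlonglongrightarrow> 0"
    using dR_bounded_sequence_convergent[of "\<lambda>k. y (r k)", OF y bd] by blast
  \<comment> \<open>Both mean distances are 1-Lipschitz, so moving their base point from the moving
    \<open>y\<close> to the fixed \<open>z\<close> costs one distance each.\<close>
  have le: "\<epsilon> \<le> \<bar>I (r (s k)) z - J z\<bar> + 2 * dR z (y (r (s k)))" for k
  proof -
    let ?n = "r (s k)"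
    have "\<epsilon> \<le> \<bar>exp (- I ?n (y ?n)) - exp (- J (y ?n))\<bar>"
      using r(2)[of "s k"] unfolding GI[OF y] GJ[OF y] .
    also have "\<dots> \<le> \<bar>I ?n (y ?n) - J (y ?n)\<bar>"
      by (intro exp_minus_diff_le nonneg)
    finally have "\<epsilon> \<le> \<bar>I ?n (y ?n) - J (y ?n)\<bar>" .
    moreover have "\<bar>I ?n z - I ?n (y ?n)\<bar> \<le> dR z (y ?n)" "\<bar>J z - J (y ?n)\<bar> \<le> dR z (y ?n)"
      using mean_dR_diff_le[OF \<nu>s intI z y] mean_dR_diff_le[OF bJ intJ z y]
      unfolding I_def J_def by blast+
    ultimately show ?thesis by linarith
  qed
  have "(\<lambda>k. I (r (s k)) z) \<longlonglongrightarrow> J z"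
    using LIMSEQ_subseq_LIMSEQ[OF conv[OF z] strict_mono_o[OF r(1) s]] by (simp add: o_def)
  then have "(\<lambda>k. \<bar>I (r (s k)) z - J z\<bar> + 2 * dR z (y (r (s k)))) \<longlonglongrightarrow> \<bar>J z - J z\<bar> + 2 * 0"
    by (intro tendsto_intros lim)
  then have "\<epsilon> \<le> \<bar>J z - J z\<bar> + 2 * 0"
    using le by (intro LIMSEQ_le_const) auto
  then show False using \<epsilon> by simp
qed

theorem theorem3p7:
  fixes \<nu> :: "'n::finite cmat measure"
  shows
   "(P1 \<nu> \<longrightarrow>
      (\<forall>y ys. y \<in> HPD \<and> (\<forall>n. ys n \<in> HPD) \<and> (\<lambda>n. dR (ys n) y) \<longlonglongrightarrow> 0 \<longrightarrow>
          (\<lambda>n. GDD \<nu> (ys n)) \<longlonglongrightarrow> GDD \<nu> y) \<and>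
      (\<forall>ys. (\<forall>n. ys n \<in> HPD) \<and> filterlim (\<lambda>n. frob (mlog (ys n))) at_top sequentially \<longrightarrow>
          (\<lambda>n. GDD \<nu> (ys n)) \<longlonglongrightarrow> 0)) \<and>
    (\<forall>\<nu>s. P1 \<nu> \<and> (\<forall>n. borel_prob_HPD (\<nu>s n)) \<and> unif_integrable \<nu>s \<and> weak_conv \<nu>s \<nu> \<longrightarrow>
       (\<lambda>n. SUP y\<in>HPD. \<bar>GDD (\<nu>s n) y - GDD \<nu> y\<bar>) \<longlonglongrightarrow> 0)"
proof (intro conjI impI allI)
  fix y :: "'n cmat" and ys
  assume \<nu>: "P1 \<nu>" and "y \<in> HPD \<and> (\<forall>n. ys n \<in> HPD) \<and> (\<lambda>n. dR (ys n) y) \<longlonglongrightarrow> 0"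
  then have y: "hpd y" and ys: "\<And>n. hpd (ys n)" and lim: "(\<lambda>n. dR (ys n) y) \<longlonglongrightarrow> 0"
    by (auto simp: HPD_iff)
  note int = P1_integrable[OF \<nu>]
  have "(\<lambda>n. (\<integral>x. dR (ys n) x \<partial>\<nu>) - (\<integral>x. dR y x \<partial>\<nu>)) \<longlonglongrightarrow> 0"
    using mean_dR_diff_le[OF int(1)[OF y] int(2) ys y]
    by (intro Lim_null_comparison[OF _ lim]) auto
  then have "(\<lambda>n. \<integral>x. dR (ys n) x \<partial>\<nu>) \<longlonglongrightarrow> (\<integral>x. dR y x \<partial>\<nu>)"
    by (simp add: LIM_zero_iff)
  then show "(\<lambda>n. GDD \<nu> (ys n)) \<longlonglongrightarrow> GDD \<nu> y"
    unfolding GDD_eq_exp[OF int(2)[OF y]] GDD_eq_exp[OF int(2)[OF ys]] by (intro tendsto_intros)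
next
  fix ys :: "nat \<Rightarrow> 'n cmat"
  assume \<nu>: "P1 \<nu>" and "(\<forall>n. ys n \<in> HPD) \<and> filterlim (\<lambda>n. lognorm (ys n)) at_top sequentially"
  then have ys: "\<And>n. hpd (ys n)" and lim: "filterlim (\<lambda>n. lognorm (ys n)) at_top sequentially"
    by (auto simp: HPD_iff)
  note int = P1_integrable[OF \<nu>]
  have "filterlim (\<lambda>n. - (\<integral>x. dR (mat 1) x \<partial>\<nu>) + lognorm (ys n)) at_top sequentially"
    by (intro filterlim_tendsto_add_at_top[OF tendsto_const lim])
  then have "filterlim (\<lambda>n. \<integral>x. dR (ys n) x \<partial>\<nu>) at_top sequentially"
    by (rule filterlim_at_top_mono)
       (use mean_dR_ge[OF int(1)[OF hpd_mat_1] int(2) ys hpd_mat_1] in \<open>simp add: dR_mat_1\<close>)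
  then show "(\<lambda>n. GDD \<nu> (ys n)) \<longlonglongrightarrow> 0"
    unfolding GDD_eq_exp[OF int(2)[OF ys]]
    by (intro filterlim_compose[OF exp_at_bot]) (simp add: filterlim_uminus_at_bot)
next
  fix \<nu>s :: "nat \<Rightarrow> 'n cmat measure"
  assume "P1 \<nu> \<and> (\<forall>n. borel_prob_HPD (\<nu>s n)) \<and> unif_integrable \<nu>s \<and> weak_conv \<nu>s \<nu>"
  then have \<nu>: "P1 \<nu>" and \<nu>s: "\<And>n. borel_prob_HPD (\<nu>s n)"
    and ui: "unif_integrable \<nu>s" and wc: "weak_conv \<nu>s \<nu>" by auto
  let ?f = "\<lambda>n y. \<bar>GDD (\<nu>s n) y - GDD \<nu> y\<bar>"
  define S where "S n = (SUP y\<in>HPD. ?f n y)" for n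
  \<comment> \<open>Depths lie between 0 and 1, so the real supremum is taken over a bounded
    set.\<close>
  have "?f n y \<le> 1" for n y
    using GDD_bounds[of \<nu> y] GDD_bounds[of "\<nu>s n" y] by (simp add: abs_le_iff)
  then have bdd: "bdd_above (?f n ` HPD)" for n by (intro bdd_aboveI2)
  have ne: "HPD \<noteq> ({} :: 'n cmat set)" using hpd_mat_1 HPD_iff by blast
  have nonneg: "S n \<ge> 0" for n
    unfolding S_def by (rule cSUP_upper2[OF bdd]) (use hpd_mat_1 in \<open>auto simp: HPD_iff\<close>)
  \<comment> \<open>The supremum may not be attained, so a point reaching at least half of it is
    chosen; when it is zero any point will do, as \<open>S n / 2 < S n\<close> fails then.\<close>
  have "\<exists>y. hpd y \<and> S n \<le> 2 * ?f n y" for n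
  proof (cases "S n = 0")
    case True
    then show ?thesis using hpd_mat_1 by (intro exI[of _ "mat 1"]) simp
  next
    case False
    then have "S n / 2 < (SUP y\<in>HPD. ?f n y)" using nonneg[of n] by (simp flip: S_def)
    then obtain y where "y \<in> HPD" "S n / 2 < ?f n y"
      unfolding less_cSUP_iff[OF ne bdd] by blast
    then show ?thesis by (intro exI[of _ y]) (simp add: HPD_iff)
  qed
  then obtain y where y: "\<And>n. hpd (y n)" and S: "\<And>n. S n \<le> 2 * ?f n (y n)" by metis
  have "(\<lambda>n. 2 * ?f n (y n)) \<longlonglongrightarrow> 2 * 0"
    by (intro tendsto_intros GDD_diff_along_sequence \<nu> \<nu>s ui wc y)
  then have "S \<longlonglongrightarrow> 0"
    by (intro Lim_null_comparison[of S "\<lambda>n. 2 * ?f n (y n)"]) (use S nonneg in auto)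
  then show "(\<lambda>n. SUP y\<in>HPD. ?f n y) \<longlonglongrightarrow> 0"
    by (simp add: S_def[abs_def])
qed

end
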